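(* Let $p$ be a prime with $p\equiv3\pmod 4$, and let $q=p_{*}^{t}$ ($t\geq1$) be a power of a prime $p_{*}$ with $p\nmid p_{*}$. If $q$ is a quadratic residue modulo $p$, then there exists a quantum code $[[tp,\ t,\ d_z/d_x]]_{p_{*}}$ such that $d_z\geq d$ and $d_x\geq d$ for a positive integer $d$ satisfying $d^2-d+1\geq p$.
   Context: An (asymmetric) quantum code $[[n,k,d_z/d_x]]_{r}$ over a prime power alphabet size $r$ is an $r^k$-dimensional subspace of $\mathbb{C}^{r^n}$ correcting all qudit-flip errors up to $\lfloor (d_x-1)/2\rfloor$ and all phase-shift errors up to $\lfloor (d_z-1)/2\rfloor$. (In the paper, $d$ is the minimum distance of the quadratic residue code of length $p$ over $\mathbb{F}_q$ with generator polynomial $\prod_{r\in Q}(x-\alpha^r)$, $Q$ the nonzero squares mod $p$, $\alpha$ a primitive $p$th root of unity.) *)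

theory Defs
  imports Complex_Main "HOL-Number_Theory.Number_Theory"
begin

text \<open>Qudit model over the alphabet Z/rZ (for r prime this is F_r).
  Computational basis of (C^r)^{\<otimes> n}: strings x with x i < r for i < n,
  extended by 0 outside {0..<n}. A state is a function from basis strings
  to complex amplitudes.\<close>

definition qbasis :: "nat \<Rightarrow> nat \<Rightarrow> (nat \<Rightarrow> nat) set" where
  "qbasis r n = {x. (\<forall>i<n. x i < r) \<and> (\<forall>i\<ge>n. x i = 0)}"

definition qinner :: "nat \<Rightarrow> nat \<Rightarrow> ((nat \<Rightarrow> nat) \<Rightarrow> complex) \<Rightarrow> ((nat \<Rightarrow> nat) \<Rightarrow> complex) \<Rightarrow> complex" where
  "qinner r n u v = (\<Sum>x\<in>qbasis r n. cnj (u x) * v x)"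

definition hweight :: "nat \<Rightarrow> (nat \<Rightarrow> nat) \<Rightarrow> nat" where
  "hweight n a = card {i. i < n \<and> a i \<noteq> 0}"

text \<open>Qudit-flip (shift) operator X(a): X(a)|y> = |y+a>.\<close>
definition Xop :: "nat \<Rightarrow> nat \<Rightarrow> (nat \<Rightarrow> nat) \<Rightarrow> ((nat \<Rightarrow> nat) \<Rightarrow> complex) \<Rightarrow> ((nat \<Rightarrow> nat) \<Rightarrow> complex)" where
  "Xop r n a \<psi> = (\<lambda>x. \<psi> (\<lambda>i. if i < n then (x i + r - a i) mod r else 0))"

definition Zop :: "nat \<Rightarrow> nat \<Rightarrow> (nat \<Rightarrow> nat) \<Rightarrow> ((nat \<Rightarrow> nat) \<Rightarrow> complex) \<Rightarrow> ((nat \<Rightarrow> nat) \<Rightarrow> complex)" where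
  "Zop r n b \<psi> = (\<lambda>x. cis (2 * pi / real r) ^ (\<Sum>i<n. b i * x i) * \<psi> x)"

definition Eop :: "nat \<Rightarrow> nat \<Rightarrow> (nat \<Rightarrow> nat) \<Rightarrow> (nat \<Rightarrow> nat) \<Rightarrow> ((nat \<Rightarrow> nat) \<Rightarrow> complex) \<Rightarrow> ((nat \<Rightarrow> nat) \<Rightarrow> complex)" where
  "Eop r n a b \<psi> = Xop r n a (Zop r n b \<psi>)"

definition qspan :: "nat \<Rightarrow> (nat \<Rightarrow> (nat \<Rightarrow> nat) \<Rightarrow> complex) \<Rightarrow> ((nat \<Rightarrow> nat) \<Rightarrow> complex) set" where
  "qspan N e = {\<psi>. \<exists>c :: nat \<Rightarrow> complex. \<psi> = (\<lambda>x. \<Sum>j<N. c j * e j x)}"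

definition asym_errors :: "nat \<Rightarrow> nat \<Rightarrow> nat \<Rightarrow> nat \<Rightarrow> ((nat \<Rightarrow> nat) \<times> (nat \<Rightarrow> nat)) set" where
  "asym_errors r n dz dx = {(a, b). a \<in> qbasis r n \<and> b \<in> qbasis r n \<and>
       hweight n a \<le> (dx - 1) div 2 \<and> hweight n b \<le> (dz - 1) div 2}"

text \<open>An asymmetric quantum code [[n,k,dz/dx]]_r: an r^k-dimensional subspace Q
  of C^(r^n) (given as span of an orthonormal family of r^k states) such that the
  error set above is correctable (Knill--Laflamme conditions).\<close>
definition is_asym_qcode :: "nat \<Rightarrow> nat \<Rightarrow> nat \<Rightarrow> nat \<Rightarrow> nat \<Rightarrow> ((nat \<Rightarrow> nat) \<Rightarrow> complex) set \<Rightarrow> bool" where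
  "is_asym_qcode r n k dz dx Q \<longleftrightarrow>
     (\<exists>e :: nat \<Rightarrow> (nat \<Rightarrow> nat) \<Rightarrow> complex.
        (\<forall>j<r^k. \<forall>x. x \<notin> qbasis r n \<longrightarrow> e j x = 0) \<and>
        (\<forall>i<r^k. \<forall>j<r^k. qinner r n (e i) (e j) = (if i = j then 1 else 0)) \<and>
        Q = qspan (r^k) e) \<and>
     (\<forall>(a1, b1)\<in>asym_errors r n dz dx. \<forall>(a2, b2)\<in>asym_errors r n dz dx.
        \<exists>c :: complex. \<forall>u\<in>Q. \<forall>v\<in>Q.
          qinner r n (Eop r n a1 b1 u) (Eop r n a2 b2 v) = c * qinner r n u v)"

end

(* A stabilizer code of CSS type is built from the quadratic residue codes of length p. Let Q be
   the circulant 0/1 matrix with Q i j = 1 iff i - j is a nonzero square modulo p. As p = 3 mod 4,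
   Q plus its transpose is J - I, and Q^2 + Q + m I = m J with m = (p + 1)/4. To avoid the
   field with ps^t elements, its role is played by V = (Z/ps)^t with an integer matrix M
   satisfying M^2 + M + m = 0 modulo ps; a word is a map from Z/p to V, and the code consists of
   the words c for which Q c - M c is constant, with the words of total 0 as subcode.

   If X^2 + X + m has a root modulo ps, M is scalar. Otherwise quadratic reciprocity (for
   ps = 2: the parity of the number of ways to write 1 as a sum of two nonzero squares) shows that ps is a
   nonresidue modulo p, so t is even and M is made of 2 x 2 companion blocks.

   For c in the code of M and b in the code of the transpose of M one gets
   p <b, c> = (total of b) . (total of c). Hence the dual of the subcode is the code of the
   transpose, and a codeword with nonzero total cannot have its support disjoint from one of
   its own translates: the differences of its support cover Z/p, which is d^2 - d + 1 >= p. *)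

theory Submission
  imports Defs
begin

section \<open>CSS codes over qudits\<close>

text \<open>Over an extension of Z/ps containing a primitive p-th root of unity alpha, Q has
  eigenvalue (p - 1)/2 on the constants and, on every other character, one of the two Gauss periods:
  the sum of alpha^s over the nonzero squares s or over the nonsquares. The periods have sum -1 and
  product m; hence the polynomial X^2 + X + m, of discriminant -p. A quadratic residue code is an
  eigenspace of Q, with M as multiplication by a period.

  The obstacle is that V carries no product. Classically, for c of nonzero total, c(x) c(1/x) is a
  nonzero multiple of 1 + x + ... + x^(p-1), because a nonzero field element has a nonzero square.
  Here that product is replaced by forms (B v) . w with B M = M^T B. Such a B carries the code of M
  into the code of the transpose, so that the pairing applies, and each nonzero v needs some B with
  (B v) . v nonzero.\<close>

definition qsub :: "nat \<Rightarrow> nat \<Rightarrow> (nat \<Rightarrow> nat) \<Rightarrow> (nat \<Rightarrow> nat) \<Rightarrow> nat \<Rightarrow> nat" where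
  "qsub r n x y = (\<lambda>i. if i < n then (x i + r - y i) mod r else 0)"

definition qdot :: "nat \<Rightarrow> (nat \<Rightarrow> nat) \<Rightarrow> (nat \<Rightarrow> nat) \<Rightarrow> int" where
  "qdot n x y = (\<Sum>i<n. int (x i) * int (y i))"

definition root_char :: "nat \<Rightarrow> int \<Rightarrow> complex" where
  "root_char r k = cis (2 * pi * of_int k / of_nat r)"

lemma qsub_in_qbasis [simp]: "r > 0 \<Longrightarrow> qsub r n x y \<in> qbasis r n"
  by (simp add: qsub_def qbasis_def)

lemma zero_in_qbasis [simp]: "r > 0 \<Longrightarrow> (\<lambda>_. 0) \<in> qbasis r n"
  by (simp add: qbasis_def)

lemma qbasis_eqI:
  assumes "x \<in> qbasis r n" "y \<in> qbasis r n" "\<And>i. i < n \<Longrightarrow> [int (x i) = int (y i)] (mod int r)"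
  shows "x = y"
proof
  fix i show "x i = y i"
    using assms by (cases "i < n") (auto simp: qbasis_def cong_int_iff cong_def)
qed

lemma qsub_cong:
  assumes "y \<in> qbasis r n" "i < n"
  shows "[int (qsub r n x y i) = int (x i) - int (y i)] (mod int r)"
proof -
  have "y i < r" using assms by (auto simp: qbasis_def)
  hence "int (qsub r n x y i) = (int (x i) - int (y i) + int r) mod int r"
    using assms(2) by (simp add: qsub_def zmod_int of_nat_diff algebra_simps)
  thus ?thesis by (simp add: cong_def)
qed

lemma qdot_qsub_left:
  assumes "y \<in> qbasis r n"
  shows "[qdot n (qsub r n x y) z = qdot n x z - qdot n y z] (mod int r)"
proof -
  have "[qdot n (qsub r n x y) z = (\<Sum>i<n. (int (x i) - int (y i)) * int (z i))] (mod int r)"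
    unfolding qdot_def by (intro cong_sum cong_mult qsub_cong assms) auto
  thus ?thesis by (simp add: qdot_def algebra_simps sum_subtractf)
qed

lemma qdot_commute: "qdot n x y = qdot n y x"
  by (simp add: qdot_def mult.commute)

lemma qdot_qsub_right:
  assumes "y \<in> qbasis r n"
  shows "[qdot n z (qsub r n x y) = qdot n z x - qdot n z y] (mod int r)"
  using qdot_qsub_left[OF assms, of x z] by (simp add: qdot_commute)

lemma qsub_qsub_zero:
  assumes "r > 0" "x \<in> qbasis r n" "a \<in> qbasis r n"
  shows "qsub r n (qsub r n x a) (qsub r n (\<lambda>_. 0) a) = x"
proof (rule qbasis_eqI[of _ r n])
  fix i assume i: "i < n"
  have "[int (qsub r n (qsub r n x a) (qsub r n (\<lambda>_. 0) a) i)
      = int (qsub r n x a i) - int (qsub r n (\<lambda>_. 0) a i)] (mod int r)"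
    using assms i by (intro qsub_cong) auto
  also have "[int (qsub r n x a i) - int (qsub r n (\<lambda>_. 0) a i)
      = (int (x i) - int (a i)) - (int 0 - int (a i))] (mod int r)"
    by (intro cong_diff qsub_cong[OF assms(3) i, of x] qsub_cong[OF assms(3) i, of "\<lambda>_. 0"])
  finally show "[int (qsub r n (qsub r n x a) (qsub r n (\<lambda>_. 0) a) i) = int (x i)] (mod int r)"
    by simp
qed (use assms in auto)

lemma qsub_zero_qsub:
  assumes "r > 0" "x \<in> qbasis r n" "a \<in> qbasis r n"
  shows "qsub r n (qsub r n x (qsub r n (\<lambda>_. 0) a)) a = x"
proof (rule qbasis_eqI[of _ r n])
  fix i assume i: "i < n"
  have "[int (qsub r n (qsub r n x (qsub r n (\<lambda>_. 0) a)) a i)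
      = int (qsub r n x (qsub r n (\<lambda>_. 0) a) i) - int (a i)] (mod int r)"
    using assms i by (intro qsub_cong) auto
  also have "[int (qsub r n x (qsub r n (\<lambda>_. 0) a) i) - int (a i)
      = (int (x i) - int (qsub r n (\<lambda>_. 0) a i)) - int (a i)] (mod int r)"
    using assms i by (intro cong_diff qsub_cong) auto
  also have "[(int (x i) - int (qsub r n (\<lambda>_. 0) a i)) - int (a i)
      = (int (x i) - (int 0 - int (a i))) - int (a i)] (mod int r)"
    using assms i qsub_cong[OF assms(3) i, of "\<lambda>_. 0"] by (intro cong_diff) auto
  finally show "[int (qsub r n (qsub r n x (qsub r n (\<lambda>_. 0) a)) a i) = int (x i)] (mod int r)"
    by simp
qed (use assms in auto)

lemma qsub_shift:
  assumes "r > 0" "x \<in> qbasis r n" "a \<in> qbasis r n" "b \<in> qbasis r n"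
  shows "qsub r n (qsub r n x a) (qsub r n b a) = qsub r n x b"
proof (rule qbasis_eqI[of _ r n])
  fix i assume i: "i < n"
  have "[int (qsub r n (qsub r n x a) (qsub r n b a) i)
      = int (qsub r n x a i) - int (qsub r n b a i)] (mod int r)"
    using assms i by (intro qsub_cong) auto
  also have "[int (qsub r n x a i) - int (qsub r n b a i)
      = (int (x i) - int (a i)) - (int (b i) - int (a i))] (mod int r)"
    using qsub_cong[OF assms(3) i] by (intro cong_diff) auto
  also have "(int (x i) - int (a i)) - (int (b i) - int (a i)) = int (x i) - int (b i)" by simp
  also have "[int (x i) - int (b i) = int (qsub r n x b i)] (mod int r)"
    using qsub_cong[OF assms(4) i] by (rule cong_sym)
  finally show "[int (qsub r n (qsub r n x a) (qsub r n b a) i) = int (qsub r n x b i)] (mod int r)" .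
qed (use assms in auto)

lemma qsub_self:
  assumes "y \<in> qbasis r n"
  shows "qsub r n y y = (\<lambda>_. 0)"
  using assms by (auto simp: qsub_def qbasis_def fun_eq_iff)

lemma sum_qbasis_translate:
  assumes "r > 0" "a \<in> qbasis r n"
  shows "(\<Sum>x\<in>qbasis r n. f (qsub r n x a)) = (\<Sum>x\<in>qbasis r n. f x)"
  by (rule sum.reindex_bij_witness[of _ "\<lambda>x. qsub r n x (qsub r n (\<lambda>_. 0) a)" "\<lambda>x. qsub r n x a"])
    (use assms in \<open>auto simp: qsub_qsub_zero qsub_zero_qsub\<close>)

lemma bij_betw_qbasis_PiE:
  "bij_betw (\<lambda>x. restrict x {..<n}) (qbasis r n) ({..<n} \<rightarrow>\<^sub>E {..<r})"
proof (rule bij_betw_imageI)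
  show "inj_on (\<lambda>x. restrict x {..<n}) (qbasis r n)"
  proof (rule inj_onI, rule ext)
    fix x y i assume "x \<in> qbasis r n" "y \<in> qbasis r n" "restrict x {..<n} = restrict y {..<n}"
    thus "x i = y i"
      by (cases "i < n") (auto simp: qbasis_def dest: fun_cong[of _ _ i])
  qed
  show "(\<lambda>x. restrict x {..<n}) ` qbasis r n = {..<n} \<rightarrow>\<^sub>E {..<r}"
  proof (intro equalityI subsetI)
    fix y assume y: "y \<in> {..<n} \<rightarrow>\<^sub>E {..<r}"
    have "(\<lambda>i. if i < n then y i else 0) \<in> qbasis r n"
      using PiE_mem[OF y] by (simp add: qbasis_def)
    moreover have "y = restrict (\<lambda>i. if i < n then y i else 0) {..<n}"
      using PiE_arb[OF y] by (auto simp: restrict_def fun_eq_iff)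
    ultimately show "y \<in> (\<lambda>x. restrict x {..<n}) ` qbasis r n" by (metis (no_types, lifting) image_eqI)
  next
    fix y assume "y \<in> (\<lambda>x. restrict x {..<n}) ` qbasis r n"
    then obtain x where "x \<in> qbasis r n" "y = restrict x {..<n}" by blast
    thus "y \<in> {..<n} \<rightarrow>\<^sub>E {..<r}" by (simp add: qbasis_def restrict_PiE_iff)
  qed
qed

lemma card_qbasis: "card (qbasis r n) = r ^ n"
  using bij_betw_same_card[OF bij_betw_qbasis_PiE, of r n] by (simp add: card_PiE)

lemma finite_qbasis [simp]: "finite (qbasis r n)"
  using bij_betw_finite[OF bij_betw_qbasis_PiE, of r n] by (simp add: finite_PiE)

section \<open>Additive characters modulo r and the error operators\<close>

lemma root_char_add: "root_char r (x + y) = root_char r x * root_char r y"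
  by (simp add: root_char_def cis_mult add_divide_distrib distrib_left)

lemma cnj_root_char: "cnj (root_char r x) = root_char r (- x)"
  by (simp add: root_char_def cis_cnj)

lemma root_char_eq_1_iff:
  assumes "r > 0"
  shows "root_char r x = 1 \<longleftrightarrow> int r dvd x"
proof
  assume "root_char r x = 1"
  hence "cos (2 * pi * of_int x / of_nat r) = 1"
    by (simp add: root_char_def complex_eq_iff)
  then obtain k :: int where k: "2 * pi * of_int x / of_nat r = of_int k * 2 * pi"
    by (auto simp: cos_one_2pi_int)
  hence "of_int x = (of_int k * of_nat r :: real)" using assms by (simp add: field_simps)
  hence "x = k * int r" by (metis of_int_eq_iff of_int_mult of_int_of_nat_eq)
  thus "int r dvd x" by simp
next
  assume "int r dvd x"
  then obtain k where "x = int r * k" by auto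
  hence "2 * pi * of_int x / of_nat r = 2 * pi * of_int k" using assms by simp
  thus "root_char r x = 1" unfolding root_char_def by (simp only: cis_multiple_2pi[OF Ints_of_int])
qed

lemma root_char_cong:
  assumes "r > 0" "[x = y] (mod int r)"
  shows "root_char r x = root_char r y"
proof -
  have "int r dvd x - y" using assms(2) by (simp add: cong_iff_dvd_diff)
  hence "root_char r (x - y) = 1" using root_char_eq_1_iff assms(1) by blast
  thus ?thesis using root_char_add[of r "x - y" y] by simp
qed

lemma Zop_eq: "Zop r n b \<psi> x = root_char r (qdot n b x) * \<psi> x"
  by (simp add: Zop_def root_char_def qdot_def Complex.DeMoivre mult_ac)

lemma Eop_eq: "Eop r n a b \<psi> x = root_char r (qdot n b (qsub r n x a)) * \<psi> (qsub r n x a)"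
  by (simp add: Eop_def Xop_def Zop_eq flip: qsub_def)

text \<open>The substitution y = x - a1 merges the two errors into a single one with shift
  \<open>a\<close> and phase \<open>b\<close>, up to a scalar that does not depend on the states.
  The Knill-Laflamme condition for pairs thus becomes a condition on differences of errors.\<close>

lemma qinner_Eop:
  fixes b2 :: "nat \<Rightarrow> nat"
  assumes "r > 0" "a1 \<in> qbasis r n" "a2 \<in> qbasis r n" "b1 \<in> qbasis r n"
  defines "a \<equiv> qsub r n a2 a1" and "b \<equiv> qsub r n b2 b1"
  shows "qinner r n (Eop r n a1 b1 u) (Eop r n a2 b2 v) =
    root_char r (- qdot n b2 a) *
      (\<Sum>y\<in>qbasis r n. root_char r (qdot n b y) * cnj (u y) * v (qsub r n y a))"
proof -
  have a: "a \<in> qbasis r n" using assms by simp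
  have "qinner r n (Eop r n a1 b1 u) (Eop r n a2 b2 v) =
    (\<Sum>x\<in>qbasis r n. cnj (root_char r (qdot n b1 (qsub r n x a1)) * u (qsub r n x a1)) *
       (root_char r (qdot n b2 (qsub r n (qsub r n x a1) a)) * v (qsub r n (qsub r n x a1) a)))"
    unfolding qinner_def a_def
    by (intro sum.cong) (simp_all add: Eop_eq qsub_shift assms)
  also have "\<dots> = (\<Sum>y\<in>qbasis r n. cnj (root_char r (qdot n b1 y) * u y) *
       (root_char r (qdot n b2 (qsub r n y a)) * v (qsub r n y a)))"
    by (rule sum_qbasis_translate) (use assms in auto)
  also have "\<dots> = (\<Sum>y\<in>qbasis r n. root_char r (- qdot n b2 a) *
      (root_char r (qdot n b y) * cnj (u y) * v (qsub r n y a)))"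
  proof (rule sum.cong)
    fix y
    have "root_char r (qdot n b2 (qsub r n y a)) = root_char r (qdot n b2 y + - qdot n b2 a)"
      using qdot_qsub_right[OF a, of b2 y] assms(1) by (intro root_char_cong) auto
    moreover have "root_char r (qdot n b y) = root_char r (qdot n b2 y + - qdot n b1 y)"
      using qdot_qsub_left[OF assms(4), of b2 y] assms(1) by (intro root_char_cong) (auto simp: b_def)
    ultimately show "cnj (root_char r (qdot n b1 y) * u y) *
       (root_char r (qdot n b2 (qsub r n y a)) * v (qsub r n y a)) = root_char r (- qdot n b2 a) *
      (root_char r (qdot n b y) * cnj (u y) * v (qsub r n y a))"
      by (simp only: root_char_add cnj_root_char complex_cnj_mult mult_ac)
  qed simp
  finally show ?thesis by (simp add: sum_distrib_left)
qed

lemma hweight_qsub_le: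
  assumes "x \<in> qbasis r n" "y \<in> qbasis r n"
  shows "hweight n (qsub r n x y) \<le> hweight n x + hweight n y"
proof -
  have "{i. i < n \<and> qsub r n x y i \<noteq> 0} \<subseteq> {i. i < n \<and> x i \<noteq> 0} \<union> {i. i < n \<and> y i \<noteq> 0}"
    using assms by (auto simp: qsub_def intro!: gr0I)
  hence "hweight n (qsub r n x y) \<le> card ({i. i < n \<and> x i \<noteq> 0} \<union> {i. i < n \<and> y i \<noteq> 0})"
    unfolding hweight_def by (intro card_mono) auto
  also have "\<dots> \<le> hweight n x + hweight n y" unfolding hweight_def by (rule card_Un_le)
  finally show ?thesis .
qed

text \<open>The smaller code of the CSS pair is \<open>{c \<in> C. S c = 0}\<close>; the values of \<open>S\<close> label its cosets
  in \<open>C\<close>, hence the logical basis states.\<close>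

locale css =
  fixes r n k d :: nat and C :: "(nat \<Rightarrow> nat) set" and S :: "(nat \<Rightarrow> nat) \<Rightarrow> nat \<Rightarrow> nat"
  assumes r_pos: "r > 0" and d_pos: "d > 0"
    and C_sub: "C \<subseteq> qbasis r n"
    and C_qsub: "\<And>x y. x \<in> C \<Longrightarrow> y \<in> C \<Longrightarrow> qsub r n x y \<in> C"
    and S_qsub: "\<And>x y. x \<in> C \<Longrightarrow> y \<in> C \<Longrightarrow> S (qsub r n x y) = qsub r k (S x) (S y)"
    and S_image: "S ` C = qbasis r k"
    and flip_distance: "\<And>a. a \<in> C \<Longrightarrow> hweight n a < d \<Longrightarrow> S a = (\<lambda>_. 0)"
    and phase_distance: "\<And>b c. b \<in> qbasis r n \<Longrightarrow> hweight n b < d \<Longrightarrow>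
      (\<And>c'. c' \<in> C \<Longrightarrow> S c' = (\<lambda>_. 0) \<Longrightarrow> int r dvd qdot n b c') \<Longrightarrow> c \<in> C \<Longrightarrow> int r dvd qdot n b c"
begin

lemma in_qbasis: "x \<in> C \<Longrightarrow> x \<in> qbasis r n"
  using C_sub by auto

lemma S_in_qbasis: "x \<in> C \<Longrightarrow> S x \<in> qbasis r k"
  using S_image by auto

lemma zero_in_C: "(\<lambda>_. 0) \<in> C"
proof -
  have "(\<lambda>_. 0) \<in> S ` C" using r_pos by (simp add: S_image)
  then obtain x where x: "x \<in> C" by auto
  show ?thesis using C_qsub[OF x x] qsub_self[OF in_qbasis[OF x]] by simp
qed

lemma qsub_in_C_iff:
  assumes "a \<in> C" "y \<in> qbasis r n"
  shows "qsub r n y a \<in> C \<longleftrightarrow> y \<in> C"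
proof
  assume "qsub r n y a \<in> C"
  hence "qsub r n (qsub r n y a) (qsub r n (\<lambda>_. 0) a) \<in> C"
    using assms by (simp add: C_qsub zero_in_C)
  thus "y \<in> C" by (simp only: qsub_qsub_zero[OF r_pos assms(2) in_qbasis[OF assms(1)]])
qed (use assms in \<open>auto intro: C_qsub\<close>)

lemma S_qsub_eq:
  assumes "a \<in> C" "S a = (\<lambda>_. 0)" "y \<in> C"
  shows "S (qsub r n y a) = S y"
proof -
  have "qsub r k (S y) (\<lambda>_. 0) = S y"
    using r_pos S_in_qbasis[OF assms(3)] qsub_cong[of "\<lambda>_. 0" r k]
    by (intro qbasis_eqI[of _ r k]) auto
  thus ?thesis using S_qsub[OF assms(3,1)] assms(2) by simp
qed

definition fibre :: "(nat \<Rightarrow> nat) \<Rightarrow> (nat \<Rightarrow> nat) set" where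
  "fibre s = {x \<in> C. S x = s}"

lemma finite_fibre: "finite (fibre s)"
  by (rule finite_subset[of _ "qbasis r n"]) (use C_sub in \<open>auto simp: fibre_def\<close>)

text \<open>Translation by a preimage x of s matches the two fibres. Addition of x is expressed as
  subtraction of 0 - x, because C is only known to be closed under \<open>qsub\<close>.\<close>

lemma card_fibre:
  assumes "s \<in> qbasis r k"
  shows "card (fibre s) = card (fibre (\<lambda>_. 0))"
proof -
  obtain x where x: "x \<in> C" "S x = s" using assms by (metis S_image imageE)
  have "S (\<lambda>_. 0) = (\<lambda>_. 0)"
    using flip_distance[OF zero_in_C] d_pos by (simp add: hweight_def)
  note neg = qsub_self[OF assms]
  let ?g = "\<lambda>y. qsub r n y x" and ?h = "\<lambda>y. qsub r n y (qsub r n (\<lambda>_. 0) x)"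
  have S0: "S (?h y) = s" if "y \<in> C" "S y = (\<lambda>_. 0)" for y
  proof -
    have "S (?h y) = qsub r k (\<lambda>_. 0) (qsub r k (\<lambda>_. 0) s)"
      using that x by (simp add: S_qsub C_qsub zero_in_C \<open>S (\<lambda>_. 0) = _\<close>)
    also have "\<dots> = s"
      using qsub_qsub_zero[OF r_pos assms assms] neg by simp
    finally show ?thesis .
  qed
  have "bij_betw ?g (fibre s) (fibre (\<lambda>_. 0))"
  proof (rule bij_betw_byWitness[where f' = ?h])
    show "\<forall>y\<in>fibre s. ?h (?g y) = y" "\<forall>y\<in>fibre (\<lambda>_. 0). ?g (?h y) = y"
      using x r_pos by (simp_all add: fibre_def qsub_qsub_zero qsub_zero_qsub in_qbasis)
    show "?g ` fibre s \<subseteq> fibre (\<lambda>_. 0)"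
      using x neg by (auto simp: fibre_def S_qsub C_qsub)
    show "?h ` fibre (\<lambda>_. 0) \<subseteq> fibre s"
      using x(1) S0 by (auto simp: fibre_def C_qsub zero_in_C)
  qed
  thus ?thesis by (rule bij_betw_same_card)
qed

lemma card_fibre_pos: "card (fibre (\<lambda>_. 0)) > 0"
proof -
  have "(\<lambda>_. 0) \<in> S ` C" using r_pos by (simp add: S_image)
  thus ?thesis using finite_fibre by (auto simp: card_gt_0_iff fibre_def)
qed

text \<open>The usual CSS basis state, a uniform superposition over one coset. By
  \<open>card_fibre\<close> all cosets have the size of the zero fibre, so one normalisation serves
  every s.\<close>

definition logical :: "(nat \<Rightarrow> nat) \<Rightarrow> (nat \<Rightarrow> nat) \<Rightarrow> complex" where
  "logical s x = (if x \<in> fibre s then 1 / of_real (sqrt (card (fibre (\<lambda>_. 0)))) else 0)"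

lemma qinner_logical:
  assumes "s \<in> qbasis r k" "s' \<in> qbasis r k"
  shows "qinner r n (logical s) (logical s') = (if s = s' then 1 else 0)"
proof (cases "s = s'")
  case False
  hence "cnj (logical s x) * logical s' x = 0" for x by (auto simp: logical_def fibre_def)
  thus ?thesis using False unfolding qinner_def by (simp only: sum.neutral_const if_False)
next
  case True
  define N where "N = card (fibre (\<lambda>_. 0))"
  have N: "N > 0" using card_fibre_pos by (simp add: N_def)
  have "qinner r n (logical s) (logical s) = (\<Sum>x\<in>qbasis r n. if x \<in> fibre s then 1 / of_nat N else 0)"
    unfolding qinner_def
  proof (rule sum.cong)
    fix x
    have "complex_of_real (sqrt N) * complex_of_real (sqrt N) = of_nat N"
      by (simp flip: of_real_mult)
    thus "cnj (logical s x) * logical s x = (if x \<in> fibre s then 1 / of_nat N else 0)"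
      by (simp add: logical_def flip: N_def)
  qed simp
  also have "\<dots> = (\<Sum>x\<in>qbasis r n \<inter> fibre s. 1 / of_nat N)"
    by (rule sum.inter_restrict[symmetric]) simp
  also have "qbasis r n \<inter> fibre s = fibre s" using C_sub by (auto simp: fibre_def)
  also have "(\<Sum>x\<in>fibre s. 1 / of_nat N) = (1 :: complex)"
    using card_fibre[OF assms(1)] N by (simp add: N_def)
  finally show ?thesis using True by simp
qed

text \<open>The states enter only through vanishing outside C and being constant on cosets. If a is
  outside C, translation by a moves C off itself and all products vanish. If a is in C, it maps each
  coset to itself by \<open>flip_distance\<close>. What remains is the phase b: either it is trivial
  on C by \<open>phase_distance\<close>, or it is a nontrivial character on the subcode and the sum
  over each coset is 0.\<close>

lemma knill_laflamme_aux:
  assumes a: "a \<in> qbasis r n" "hweight n a < d" and b: "b \<in> qbasis r n" "hweight n b < d"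
    and supp: "\<And>w x. w \<in> Q \<Longrightarrow> x \<notin> C \<Longrightarrow> w x = 0"
    and coset: "\<And>w x y. w \<in> Q \<Longrightarrow> x \<in> C \<Longrightarrow> y \<in> C \<Longrightarrow> S x = S y \<Longrightarrow> w x = w y"
  shows "\<exists>c::complex. \<forall>u\<in>Q. \<forall>v\<in>Q.
    (\<Sum>y\<in>qbasis r n. root_char r (qdot n b y) * cnj (u y) * v (qsub r n y a)) = c * qinner r n u v"
proof (cases "a \<in> C")
  case False
  have "root_char r (qdot n b y) * cnj (u y) * v (qsub r n y a) = 0"
    if "u \<in> Q" "v \<in> Q" "y \<in> qbasis r n" for u v y
  proof (cases "y \<in> C \<and> qsub r n y a \<in> C")
    case True
    have "a = qsub r n y (qsub r n y a)"
    proof (rule qbasis_eqI[of _ r n])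
      fix i assume i: "i < n"
      have "[int (qsub r n y (qsub r n y a) i) = int (y i) - int (qsub r n y a i)] (mod int r)"
        using i r_pos by (intro qsub_cong) auto
      also have "[int (y i) - int (qsub r n y a i) = int (y i) - (int (y i) - int (a i))] (mod int r)"
        by (intro cong_diff cong_refl qsub_cong a i)
      finally show "[int (a i) = int (qsub r n y (qsub r n y a) i)] (mod int r)"
        by (simp add: cong_sym)
    qed (use r_pos a in auto)
    moreover have "qsub r n y (qsub r n y a) \<in> C" using True by (simp add: C_qsub)
    ultimately show ?thesis using False by simp
  qed (use supp that in auto)
  thus ?thesis by (intro exI[of _ 0]) (simp only: sum.neutral mult_zero_left, auto intro!: sum.neutral)
next
  case True
  have Sa: "S a = (\<lambda>_. 0)" using flip_distance True a by blast
  have shift: "v (qsub r n y c) = v y"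
    if "v \<in> Q" "y \<in> qbasis r n" "c \<in> C" "S c = (\<lambda>_. 0)" for v y c
  proof (cases "y \<in> C")
    case True
    thus ?thesis using that by (intro coset) (auto intro: C_qsub S_qsub_eq)
  next
    case False
    thus ?thesis using that qsub_in_C_iff supp by metis
  qed
  define f where "f u v y = root_char r (qdot n b y) * cnj (u y) * v y"
    for u v :: "(nat \<Rightarrow> nat) \<Rightarrow> complex" and y
  have eq: "(\<Sum>y\<in>qbasis r n. root_char r (qdot n b y) * cnj (u y) * v (qsub r n y a))
     = (\<Sum>y\<in>qbasis r n. f u v y)" if "u \<in> Q" "v \<in> Q" for u v
    using shift True Sa that by (intro sum.cong) (auto simp: f_def)
  show ?thesis
  proof (cases "\<forall>c\<in>C. S c = (\<lambda>_. 0) \<longrightarrow> int r dvd qdot n b c")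
    case True
    hence "root_char r (qdot n b y) = 1" if "y \<in> C" for y
      using phase_distance[OF b] that by (subst root_char_eq_1_iff[OF r_pos]) blast
    hence "f u v y = cnj (u y) * v y" if "u \<in> Q" for u v y
      using supp that by (cases "y \<in> C") (auto simp: f_def)
    thus ?thesis using eq by (intro exI[of _ 1]) (simp add: qinner_def)
  next
    case False
    then obtain c where c: "c \<in> C" "S c = (\<lambda>_. 0)" "\<not> int r dvd qdot n b c" by blast
    \<comment> \<open>Translating the summation variable by c multiplies the sum by a root of unity
      other than 1.\<close>
    have "(\<Sum>y\<in>qbasis r n. f u v y) = 0" if "u \<in> Q" "v \<in> Q" for u v
    proof -
      have "(\<Sum>y\<in>qbasis r n. f u v y) = (\<Sum>y\<in>qbasis r n. f u v (qsub r n y c))"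
        using c in_qbasis r_pos by (simp add: sum_qbasis_translate)
      also have "\<dots> = (\<Sum>y\<in>qbasis r n. root_char r (- qdot n b c) * f u v y)"
      proof (rule sum.cong)
        fix y assume y: "y \<in> qbasis r n"
        have "root_char r (qdot n b (qsub r n y c)) = root_char r (qdot n b y + - qdot n b c)"
          using qdot_qsub_right[OF in_qbasis[OF c(1)], of b y] r_pos by (intro root_char_cong) auto
        moreover have "u (qsub r n y c) = u y" "v (qsub r n y c) = v y"
          using shift c that y by blast+
        ultimately show "f u v (qsub r n y c) = root_char r (- qdot n b c) * f u v y"
          unfolding f_def by (simp only: root_char_add mult_ac)
      qed simp
      also have "\<dots> = root_char r (- qdot n b c) * (\<Sum>y\<in>qbasis r n. f u v y)"
        by (rule sum_distrib_left[symmetric])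
      finally have "(root_char r (- qdot n b c) - 1) * (\<Sum>y\<in>qbasis r n. f u v y) = 0"
        by (metis diff_self left_diff_distrib mult_1)
      moreover have "root_char r (- qdot n b c) \<noteq> 1"
        using c(3) root_char_eq_1_iff[OF r_pos] by simp
      ultimately show ?thesis by simp
    qed
    thus ?thesis using eq by (intro exI[of _ 0]) simp
  qed
qed

theorem css_asym_qcode: "\<exists>Q. is_asym_qcode r n k d d Q"
proof -
  obtain h where h: "bij_betw h {..<r^k} (qbasis r k)"
    by (metis card_qbasis card_lessThan finite_lessThan finite_qbasis finite_same_card_bij)
  define e where "e j = logical (h j)" for j
  define Q where "Q = qspan (r ^ k) e"
  have supp: "w x = 0" if "w \<in> Q" "x \<notin> C" for w x
    using that by (auto simp: Q_def qspan_def e_def logical_def fibre_def)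
  have coset: "w x = w y" if "w \<in> Q" "x \<in> C" "y \<in> C" "S x = S y" for w x y
    using that by (auto simp: Q_def qspan_def e_def logical_def fibre_def)
  have "\<exists>c::complex. \<forall>u\<in>Q. \<forall>v\<in>Q.
       qinner r n (Eop r n a1 b1 u) (Eop r n a2 b2 v) = c * qinner r n u v"
    if E: "(a1, b1) \<in> asym_errors r n d d" "(a2, b2) \<in> asym_errors r n d d" for a1 b1 a2 b2
  proof -
    have q: "a1 \<in> qbasis r n" "a2 \<in> qbasis r n" "b1 \<in> qbasis r n" "b2 \<in> qbasis r n"
      using E by (auto simp: asym_errors_def)
    \<comment> \<open>Two weights of at most (d - 1) div 2 add up to less than d.\<close>
    have "hweight n (qsub r n a2 a1) < d"
      using E hweight_qsub_le[OF q(2,1)] d_pos by (auto simp: asym_errors_def)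
    moreover have "hweight n (qsub r n b2 b1) < d"
      using E hweight_qsub_le[OF q(4,3)] d_pos by (auto simp: asym_errors_def)
    ultimately obtain c where c: "\<forall>u\<in>Q. \<forall>v\<in>Q.
      (\<Sum>y\<in>qbasis r n. root_char r (qdot n (qsub r n b2 b1) y) * cnj (u y) * v (qsub r n y (qsub r n a2 a1)))
        = c * qinner r n u v"
      using knill_laflamme_aux[of "qsub r n a2 a1" "qsub r n b2 b1" Q] supp coset r_pos by auto
    show ?thesis
      by (rule exI[of _ "root_char r (- qdot n b2 (qsub r n a2 a1)) * c"])
        (simp only: qinner_Eop[OF r_pos q(1-3)] c[rule_format] mult.assoc, use c in \<open>simp add: mult.assoc\<close>)
  qed
  moreover have "\<forall>j<r^k. \<forall>x. x \<notin> qbasis r n \<longrightarrow> e j x = 0"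
    using C_sub by (auto simp: e_def logical_def fibre_def)
  moreover have "\<forall>i<r^k. \<forall>j<r^k. qinner r n (e i) (e j) = (if i = j then 1 else 0)"
  proof (intro allI impI)
    fix i j assume "i < r^k" "j < r^k"
    moreover from this have "h i \<in> qbasis r k" "h j \<in> qbasis r k"
      using bij_betw_apply[OF h] by auto
    moreover have "h i = h j \<longleftrightarrow> i = j"
      using calculation(1,2) bij_betw_imp_inj_on[OF h] by (auto dest: inj_onD)
    ultimately show "qinner r n (e i) (e j) = (if i = j then 1 else 0)"
      by (simp add: e_def qinner_logical)
  qed
  ultimately have "is_asym_qcode r n k d d Q"
    unfolding is_asym_qcode_def Q_def by blast
  thus ?thesis ..
qed

end

section \<open>Quadratic residues modulo a prime p = 3 mod 4\<close>

text \<open>A map that is injective modulo p permutes the residues, and a periodic f does not see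
  which representative is taken. Translations, reflections and scalings are the instances
  used.\<close>

lemma sum_residues_reindex:
  fixes p :: nat and f :: "int \<Rightarrow> 'a::comm_monoid_add"
  assumes "p > 0" and per: "\<And>x. f (x mod int p) = f x"
    and inj: "\<And>x y. int p dvd h x - h y \<Longrightarrow> int p dvd x - y"
  shows "(\<Sum>i<p. f (h (int i))) = (\<Sum>i<p. f (int i))"
proof -
  define g where "g i = nat (h (int i) mod int p)" for i
  have g: "int (g i) = h (int i) mod int p" for i using assms(1) by (simp add: g_def)
  have "inj_on g {..<p}"
  proof (rule inj_onI)
    fix i j assume ij: "i \<in> {..<p}" "j \<in> {..<p}" "g i = g j"
    hence "int p dvd h (int i) - h (int j)" by (metis g mod_eq_dvd_iff)
    hence "int i mod int p = int j mod int p" using inj mod_eq_dvd_iff by blast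
    thus "i = j" using ij by simp
  qed
  moreover have "g ` {..<p} \<subseteq> {..<p}" using assms(1) by (auto simp: g_def nat_less_iff)
  ultimately have "bij_betw g {..<p} {..<p}" by (simp add: bij_betw_def endo_inj_surj)
  hence "(\<Sum>i<p. f (int i)) = (\<Sum>i<p. f (int (g i)))" by (rule sum.reindex_bij_betw[symmetric])
  thus ?thesis by (simp add: g per)
qed

locale prime_3_mod_4 =
  fixes p :: nat
  assumes prime_p: "prime p" and p_mod_4: "[p = 3] (mod 4)"
begin

definition m :: int where "m = (int p + 1) div 4"

definition chi :: "int \<Rightarrow> int" where "chi k = Legendre k (int p)"

definition res_ind :: "int \<Rightarrow> int" where "res_ind k = (if chi k = 1 then 1 else 0)"

definition div_ind :: "int \<Rightarrow> int" where "div_ind k = (if int p dvd k then 1 else 0)"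

lemma p_eq: "int p = 4 * m - 1"
proof -
  have "p mod 4 = 3" using p_mod_4 by (simp add: cong_def)
  thus ?thesis unfolding m_def by presburger
qed

lemma p_gt_2: "p > 2"
  using p_eq prime_gt_1_nat[OF prime_p] by presburger

lemma chi_cases: "chi k = -1 \<or> chi k = 0 \<or> chi k = 1"
  by (simp add: chi_def Legendre_def)

lemma chi_eq_0_iff: "chi k = 0 \<longleftrightarrow> int p dvd k"
  by (auto simp: chi_def Legendre_def cong_0_iff)

text \<open>Two of these values differ by at most 2 < p. This turns the congruences from Euler's
  criterion into equations between values of \<open>chi\<close>.\<close>

lemma small_cong_imp_eq:
  assumes "[x = y] (mod int p)" "x \<in> {-1, 0, 1}" "y \<in> {-1, 0, 1}"
  shows "x = y"
proof (rule ccontr)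
  assume "x \<noteq> y"
  moreover have "int p dvd x - y" using assms(1) by (simp add: cong_iff_dvd_diff)
  ultimately have "int p \<le> \<bar>x - y\<bar>" using dvd_imp_le_int[of "x - y" "int p"] by simp
  thus False using assms(2,3) p_gt_2 by auto
qed

lemma chi_euler: "[chi k = k ^ ((p - 1) div 2)] (mod int p)"
  unfolding chi_def using euler_criterion[OF prime_p p_gt_2] .

lemma chi_mult: "chi (a * b) = chi a * chi b"
proof (rule small_cong_imp_eq)
  have "[chi a * chi b = (a * b) ^ ((p - 1) div 2)] (mod int p)"
    unfolding power_mult_distrib by (intro cong_mult chi_euler)
  thus "[chi (a * b) = chi a * chi b] (mod int p)"
    using chi_euler cong_sym cong_trans by blast
qed (use chi_cases[of a] chi_cases[of b] chi_cases[of "a * b"] in auto)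

lemma chi_cong:
  assumes "[a = b] (mod int p)"
  shows "chi a = chi b"
proof (rule small_cong_imp_eq)
  have "[a ^ ((p - 1) div 2) = b ^ ((p - 1) div 2)] (mod int p)" by (rule cong_pow[OF assms])
  thus "[chi a = chi b] (mod int p)"
    using chi_euler cong_sym cong_trans by blast
qed (use chi_cases[of a] chi_cases[of b] in auto)

lemma chi_mod [simp]: "chi (k mod int p) = chi k"
  by (rule chi_cong) simp

lemma div_ind_mod [simp]: "div_ind (k mod int p) = div_ind k"
  by (simp add: div_ind_def dvd_mod_iff)

lemma res_ind_mod [simp]: "res_ind (k mod int p) = res_ind k"
  by (simp add: res_ind_def)

text \<open>The exponent (p - 1)/2 = 2 m - 1 in Euler's criterion is odd, so -1 is a
  nonresidue.\<close>

lemma chi_minus: "chi (- k) = - chi k"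
proof -
  have "(p - 1) div 2 = nat (2 * m - 1)" "2 * m - 1 > 0" using p_eq p_gt_2 by auto
  hence "odd ((p - 1) div 2)" by (simp add: even_nat_iff)
  hence "[chi (-1) = -1] (mod int p)" using chi_euler[of "-1"] by simp
  hence "chi (-1) = -1" using chi_cases[of "-1"] by (intro small_cong_imp_eq) auto
  thus ?thesis using chi_mult[of "-1" k] by simp
qed

lemma chi_1: "chi 1 = 1"
proof -
  have "chi 1 \<noteq> 0" using p_gt_2 by (simp add: chi_eq_0_iff)
  thus ?thesis using chi_mult[of 1 1] by simp
qed

lemma chi_square: "chi k * chi k = 1 - div_ind k"
  using chi_cases[of k] chi_eq_0_iff[of k] by (auto simp: div_ind_def)

lemma res_ind_chi: "2 * res_ind k = chi k + 1 - div_ind k"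
  using chi_cases[of k] chi_eq_0_iff[of k] by (auto simp: res_ind_def div_ind_def)

lemma res_ind_minus: "res_ind k + res_ind (- k) + div_ind k = 1"
  using res_ind_chi[of k] res_ind_chi[of "- k"] chi_minus[of k] by (simp add: div_ind_def split: if_splits)

lemma sum_shift:
  assumes "\<And>x. f (x mod int p) = f x"
  shows "(\<Sum>i<p. f (int i + s)) = (\<Sum>i<p. f (int i))"
  using sum_residues_reindex[of p f "\<lambda>x. x + s"] p_gt_2 assms by simp

lemma sum_reflect:
  assumes "\<And>x. f (x mod int p) = f x"
  shows "(\<Sum>i<p. f (s - int i)) = (\<Sum>i<p. f (int i))"
  using sum_residues_reindex[of p f "\<lambda>x. s - x"] p_gt_2 assms by (simp add: dvd_diff_commute)

lemma sum_scale:
  assumes "\<And>x. f (x mod int p) = f x" "\<not> int p dvd s"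
  shows "(\<Sum>i<p. f (s * int i)) = (\<Sum>i<p. f (int i))"
proof (rule sum_residues_reindex)
  show "int p dvd x - y" if "int p dvd s * x - s * y" for x y
    using that assms(2) prime_dvd_multD[of "int p" s "x - y"] prime_p
    by (simp add: right_diff_distrib)
qed (use assms p_gt_2 in auto)

lemma sum_div_ind:
  assumes "\<And>x. f (x mod int p) = f x"
  shows "(\<Sum>i<p. div_ind (k - int i) * f (int i)) = f k"
proof -
  define j where "j = nat (k mod int p)"
  have j: "int j = k mod int p" "j < p" using p_gt_2 by (simp_all add: j_def nat_less_iff)
  have "div_ind (k - int i) = (if i = j then 1 else 0)" if "i < p" for i
  proof -
    have "int p dvd k - int i \<longleftrightarrow> k mod int p = int i mod int p" by (simp add: mod_eq_dvd_iff)
    also have "\<dots> \<longleftrightarrow> i = j" using that j by auto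
    finally show ?thesis by (simp add: div_ind_def)
  qed
  hence "(\<Sum>i<p. div_ind (k - int i) * f (int i)) = (\<Sum>i<p. if i = j then f (int i) else 0)"
    by (intro sum.cong) auto
  also have "\<dots> = f k" using j assms by (simp add: sum.delta)
  finally show ?thesis .
qed

lemma sum_div_ind': "(\<Sum>i<p. div_ind (k - int i)) = 1"
  using sum_div_ind[of "\<lambda>_. 1"] by simp

lemma sum_div_ind_0: "(\<Sum>i<p. div_ind (int i)) = 1"
  using sum_div_ind'[of 0] by (simp add: div_ind_def)

text \<open>The reflection i -> - i turns the sum into its negative, as \<open>chi\<close> is
  odd.\<close>

lemma sum_chi: "(\<Sum>i<p. chi (int i)) = 0"
  using sum_reflect[of chi 0] by (simp add: chi_minus sum_negf)

section \<open>The convolution of the quadratic character with itself (a Jacobi sum)\<close>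

definition jac :: "int \<Rightarrow> int" where "jac k = (\<Sum>i<p. chi (int i) * chi (k - int i))"

lemma jac_0: "jac 0 = 1 - int p"
proof -
  have "jac 0 = (\<Sum>i<p. div_ind (int i) - 1)"
    unfolding jac_def by (intro sum.cong) (simp_all add: chi_minus chi_square)
  thus ?thesis by (simp add: sum_subtractf sum_div_ind_0)
qed

lemma chi_diff_mod: "chi (k - x mod int p) = chi (k - x)"
  by (rule chi_cong) (simp add: cong_def mod_simps)

text \<open>Substituting k i for i pulls out the factor \<open>chi k\<close> twice, and its square
  is 1.\<close>

lemma jac_scale:
  assumes "\<not> int p dvd k"
  shows "jac k = jac 1"
proof -
  have "jac k = (\<Sum>i<p. chi (k * int i) * chi (k - k * int i))"
    unfolding jac_def
    by (rule sum_scale[of "\<lambda>x. chi x * chi (k - x)", symmetric]) (use assms in \<open>simp_all add: chi_diff_mod\<close>)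
  also have "\<dots> = (\<Sum>i<p. (chi k * chi k) * (chi (int i) * chi (1 - int i)))"
  proof (rule sum.cong)
    fix i
    have "chi (k - k * int i) = chi k * chi (1 - int i)"
      by (simp add: right_diff_distrib flip: chi_mult)
    thus "chi (k * int i) * chi (k - k * int i) = (chi k * chi k) * (chi (int i) * chi (1 - int i))"
      by (simp add: chi_mult)
  qed simp
  also have "chi k * chi k = 1" using assms by (simp add: chi_square div_ind_def)
  finally show ?thesis by (simp add: jac_def)
qed

text \<open>Summed over all k, the convolution gives the square of the sum of \<open>chi\<close>,
  which is 0. One term is \<open>jac 0\<close> = 1 - p and the other p - 1 terms are equal, so each
  of them is 1.\<close>

lemma jac_1: "jac 1 = 1"
proof -
  have "(\<Sum>k<p. jac (int k)) = (\<Sum>i<p. \<Sum>k<p. chi (int i) * chi (int k - int i))"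
    unfolding jac_def by (rule sum.swap)
  also have "\<dots> = (\<Sum>i<p. chi (int i) * (\<Sum>k<p. chi (int k + - int i)))"
    by (simp add: sum_distrib_left)
  also have "\<dots> = 0" by (simp only: sum_shift[where f = chi, OF chi_mod] sum_chi) simp
  finally have "(\<Sum>k<p. jac (int k)) = 0" .
  moreover have "{..<p} = insert 0 {1..<p}" using p_gt_2 by auto
  ultimately have "jac 0 + (\<Sum>k=1..<p. jac (int k)) = 0" by simp
  moreover have "(\<Sum>k=1..<p. jac (int k)) = (\<Sum>k=1..<p. jac 1)"
  proof (rule sum.cong)
    fix k assume "k \<in> {1..<p}"
    hence "\<not> int p dvd int k" by (auto dest: dvd_imp_le)
    thus "jac (int k) = jac 1" by (rule jac_scale)
  qed simp
  ultimately have "jac 0 + (int p - 1) * jac 1 = 0" using p_gt_2 by (simp add: of_nat_diff)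
  hence "(int p - 1) * jac 1 = int p - 1" by (simp only: jac_0 add_eq_0_iff minus_diff_eq)
  thus ?thesis using p_gt_2 by simp
qed

lemma sum_res_ind: "(\<Sum>i<p. res_ind (int i)) = 2 * m - 1"
proof -
  have "2 * (\<Sum>i<p. res_ind (int i)) = (\<Sum>i<p. chi (int i) + 1 - div_ind (int i))"
    by (simp add: sum_distrib_left res_ind_chi)
  also have "\<dots> = int p - 1"
    by (simp add: sum.distrib sum_subtractf sum_chi sum_div_ind_0)
  finally show ?thesis using p_eq by simp
qed

text \<open>This is the relation Q^2 + Q + m I = m J read at index difference k. Expanding with 2
  \<open>res_ind\<close> = \<open>chi\<close> + 1 - \<open>div_ind\<close> leaves the convolution
  \<open>jac k\<close> and sums with known values.\<close>

lemma res_ind_convolution: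
  "(\<Sum>i<p. res_ind (int i) * res_ind (k - int i)) + res_ind k + m * div_ind k = m"
proof -
  have "4 * (\<Sum>i<p. res_ind (int i) * res_ind (k - int i))
      = (\<Sum>i<p. (2 * res_ind (int i)) * (2 * res_ind (k - int i)))"
    by (simp add: sum_distrib_left mult_ac)
  \<comment> \<open>In products, \<open>div_ind (int i)\<close> is written as
    \<open>div_ind (0 - int i)\<close>, the shape that \<open>sum_div_ind\<close> evaluates.\<close>
  also have "\<dots> = (\<Sum>i<p. chi (int i) * chi (k - int i) + chi (int i) + chi (k - int i) + 1
      - div_ind (k - int i) * chi (int i) - div_ind (0 - int i) * chi (k - int i)
      - div_ind (int i) - div_ind (k - int i) + div_ind (0 - int i) * div_ind (k - int i))"
  proof (rule sum.cong)
    fix i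
    have "div_ind (0 - int i) = div_ind (int i)" by (simp add: div_ind_def)
    thus "(2 * res_ind (int i)) * (2 * res_ind (k - int i)) = chi (int i) * chi (k - int i) + chi (int i)
      + chi (k - int i) + 1 - div_ind (k - int i) * chi (int i) - div_ind (0 - int i) * chi (k - int i)
      - div_ind (int i) - div_ind (k - int i) + div_ind (0 - int i) * div_ind (k - int i)"
      by (simp only: res_ind_chi) (simp add: algebra_simps)
  qed simp
  also have "\<dots> = jac k + 0 + 0 + int p - chi k - chi (k - 0) - 1 - 1 + div_ind (k - 0)"
  proof -
    have "(\<Sum>i<p. div_ind (k - int i) * chi (int i)) = chi k" by (rule sum_div_ind) simp
    moreover have "(\<Sum>i<p. div_ind (0 - int i) * chi (k - int i)) = chi (k - 0)"
      by (rule sum_div_ind) (simp add: chi_diff_mod)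
    moreover have "(\<Sum>i<p. div_ind (0 - int i) * div_ind (k - int i)) = div_ind (k - 0)"
      by (rule sum_div_ind) (metis div_ind_mod mod_diff_right_eq)
    moreover have "(\<Sum>i<p. chi (k - int i)) = 0" by (simp add: sum_reflect sum_chi)
    ultimately show ?thesis
      by (simp only: sum.distrib sum_subtractf jac_def sum_chi sum_div_ind_0 sum_div_ind') simp
  qed
  finally have *: "4 * (\<Sum>i<p. res_ind (int i) * res_ind (k - int i))
      = jac k + int p - 2 * chi k - 2 + div_ind k" by simp
  show ?thesis
  proof (cases "int p dvd k")
    case True
    hence "jac k = jac 0" unfolding jac_def
      by (intro sum.cong) (auto intro!: chi_cong arg_cong2[where f="(*)"] simp: cong_iff_dvd_diff)
    thus ?thesis using True * res_ind_chi[of k] chi_eq_0_iff[of k] by (simp add: jac_0 div_ind_def)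
  next
    case False
    thus ?thesis using * res_ind_chi[of k] jac_scale[OF False] jac_1 p_eq by (simp add: div_ind_def)
  qed
qed

text \<open>By \<open>res_ind_convolution\<close> at k = 1 the set X below has m - 1 elements. The
  involution i -> 1 - i of X has exactly one fixed point, the residue of 1/2, which lies in X
  because 2 is a square. Hence m - 1 is odd.\<close>

lemma even_m_if_chi_2:
  assumes "chi 2 = 1"
  shows "even m"
proof -
  define X where "X = {i. i < p \<and> chi (int i) = 1 \<and> chi (1 - int i) = 1}"
  define g where "g i = nat ((1 - int i) mod int p)" for i
  have "finite X" by (simp add: X_def)
  have "(\<Sum>i<p. res_ind (int i) * res_ind (1 - int i)) = (\<Sum>i\<in>{..<p} \<inter> X. 1)"
    by (subst sum.inter_restrict) (auto simp: res_ind_def X_def intro!: sum.cong)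
  also have "{..<p} \<inter> X = X" by (auto simp: X_def)
  finally have card: "int (card X) = m - 1"
    using res_ind_convolution[of 1] p_gt_2 chi_1 by (simp add: div_ind_def res_ind_def)
  have gi: "int (g i) = (1 - int i) mod int p" for i using p_gt_2 by (simp add: g_def)
  have gX: "g i \<in> X" if "i \<in> X" for i
  proof -
    have "chi (1 - int (g i)) = chi (int i)"
      unfolding gi by (simp add: chi_diff_mod)
    moreover have "g i < p" using p_gt_2 by (simp add: g_def nat_less_iff)
    ultimately show ?thesis using that by (simp add: X_def gi)
  qed
  have gg: "g (g i) = i" if "i \<in> X" for i
  proof -
    have "int (g (g i)) = int i mod int p" by (simp add: gi mod_simps)
    thus ?thesis using that by (simp add: X_def)
  qed
  \<comment> \<open>As 4 m = p + 1, this is (p + 1)/2, the inverse of 2 modulo p.\<close>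
  define h where "h = nat (2 * m)"
  have h: "int h = 2 * m" "h < p" using p_eq p_gt_2 by (auto simp: h_def)
  have "chi (int h) * chi 2 = chi (int h * 2)" by (simp add: chi_mult)
  also have "\<dots> = chi 1" by (rule chi_cong) (simp add: h p_eq cong_iff_dvd_diff)
  finally have "chi (int h) = 1" using assms chi_1 by simp
  moreover have "chi (1 - int h) = chi (int h)"
  proof (rule chi_cong)
    have "1 - int h - int h = - int p" using h p_eq by simp
    thus "[1 - int h = int h] (mod int p)" by (simp add: cong_iff_dvd_diff)
  qed
  ultimately have hX: "h \<in> X" using h by (simp add: X_def)
  have fix_iff: "g i = i \<longleftrightarrow> i = h" if "i \<in> X" for i
  proof -
    have i: "i < p" using that by (simp add: X_def)
    have "g i = i \<longleftrightarrow> (1 - int i) mod int p = int i mod int p" using i gi[of i] by auto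
    also have "\<dots> \<longleftrightarrow> int p dvd 1 - 2 * int i" by (simp add: mod_eq_dvd_iff)
    also have "\<dots> \<longleftrightarrow> i = h"
    proof
      assume "int p dvd 1 - 2 * int i"
      then obtain c where c: "1 - 2 * int i = int p * c" by auto
      \<comment> \<open>The number 1 - 2 i is odd and lies between -2 p and 1, so its quotient by p
        is odd, less than 1 and greater than -3.\<close>
      have "c = -1"
      proof -
        have "odd (1 - 2 * int i)" by simp
        hence "odd c" unfolding c by simp
        moreover have "c < 1"
        proof (rule ccontr)
          assume "\<not> c < 1"
          hence "int p * c \<ge> int p * 1" by (intro mult_left_mono) auto
          thus False using c p_gt_2 by linarith
        qed
        moreover have "c > -3"
        proof (rule ccontr)
          assume "\<not> c > -3"
          hence "int p * c \<le> int p * (-3)" by (intro mult_left_mono) auto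
          thus False using c i by linarith
        qed
        ultimately show ?thesis by presburger
      qed
      thus "i = h" using c h p_eq by simp
    next
      assume "i = h"
      hence "1 - 2 * int i = - int p" using h p_eq by simp
      thus "int p dvd 1 - 2 * int i" by simp
    qed
    finally show ?thesis .
  qed
  have "bij_betw g {i \<in> X. i < g i} {i \<in> X. g i < i}"
    by (rule bij_betw_byWitness[where f' = g]) (auto simp: gX gg)
  hence eq: "card {i \<in> X. i < g i} = card {i \<in> X. g i < i}" by (rule bij_betw_same_card)
  have "X = insert h ({i \<in> X. i < g i} \<union> {i \<in> X. g i < i})"
    using fix_iff hX by (auto, metis linorder_neqE_nat)
  hence "card X = card (insert h ({i \<in> X. i < g i} \<union> {i \<in> X. g i < i}))" by simp
  also have "\<dots> = Suc (card ({i \<in> X. i < g i} \<union> {i \<in> X. g i < i}))"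
    using fix_iff[OF hX] \<open>finite X\<close> by (intro card_insert_disjoint) auto
  also have "\<dots> = Suc (2 * card {i \<in> X. i < g i})"
    using \<open>finite X\<close> eq by (subst card_Un_disjoint) auto
  finally have "odd (int (card X))" by simp
  thus ?thesis using card by presburger
qed

text \<open>The discriminant of X^2 + X + m is -p. For odd r one therefore needs -p to be a square
  modulo r, which for p = 3 mod 4 is what reciprocity makes of r being a square modulo p. For r = 2
  the evenness of m makes 0 a root.\<close>

lemma root_exists:
  fixes r :: nat
  assumes "prime r" "r \<noteq> p" "QuadRes (int p) (int r)"
  shows "\<exists>x. int r dvd x ^ 2 + x + m"
proof -
  have "\<not> p dvd r" using assms prime_p primes_dvd_imp_eq by blast
  hence chi_r: "chi (int r) = 1"
    using assms(3) by (simp add: chi_def Legendre_def cong_0_iff int_dvd_int_iff)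
  show ?thesis
  proof (cases "r = 2")
    case True
    thus ?thesis using even_m_if_chi_2 chi_r by (intro exI[of _ 0]) simp
  next
    case False
    hence r: "r > 2" using prime_ge_2_nat[OF assms(1)] by simp
    hence "odd r" using assms(1) prime_odd_nat by blast
    have npr: "\<not> r dvd p" using assms prime_p primes_dvd_imp_eq by blast
    have rec: "Legendre (int p) (int r) = (-1) ^ ((p - 1) div 2 * ((r - 1) div 2))"
      using Quadratic_Reciprocity[OF prime_p p_gt_2 assms(1) r] assms(2) chi_r by (simp add: chi_def)
    have "(p - 1) div 2 = nat (2 * m - 1)" "2 * m - 1 > 0" using p_eq p_gt_2 by auto
    hence "odd ((p - 1) div 2)" by (simp add: even_nat_iff)
    hence "Legendre (int p) (int r) = (-1) ^ ((r - 1) div 2)"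
      using rec by (simp add: power_mult)
    moreover have "[Legendre (int p) (int r) = int p ^ ((r - 1) div 2)] (mod int r)"
      by (rule euler_criterion[OF assms(1) r])
    \<comment> \<open>The sign from reciprocity is moved into the base of the power, so that Euler's
      criterion applies to -p.\<close>
    ultimately have "[(-1) ^ ((r - 1) div 2) * int p ^ ((r - 1) div 2)
         = (-1) ^ ((r - 1) div 2) * (-1) ^ ((r - 1) div 2)] (mod int r)"
      by (intro cong_mult) (auto simp: cong_sym)
    hence "[(- int p) ^ ((r - 1) div 2) = 1] (mod int r)"
      by (simp flip: power_mult_distrib)
    hence "[Legendre (- int p) (int r) = 1] (mod int r)"
      using euler_criterion[OF assms(1) r, of "- int p"] cong_trans by blast
    moreover have "Legendre (- int p) (int r) \<noteq> -1"
    proof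
      assume "Legendre (- int p) (int r) = -1"
      with calculation have "int r dvd 2" by (simp add: cong_iff_dvd_diff)
      thus False using r by (auto dest: zdvd_imp_le)
    qed
    moreover have "Legendre (- int p) (int r) \<noteq> 0"
      using npr by (simp add: Legendre_def cong_0_iff int_dvd_int_iff)
    ultimately have "QuadRes (int r) (- int p)"
      by (auto simp: Legendre_def split: if_splits)
    then obtain y0 where y0: "[y0 ^ 2 = - int p] (mod int r)" by (auto simp: QuadRes_def)
    \<comment> \<open>Since r is odd, adding it changes parity. An odd y has the form 2 x + 1, and
      then y^2 + p = 4 (x^2 + x + m).\<close>
    define y where "y = (if odd y0 then y0 else y0 + int r)"
    have "odd y" using \<open>odd r\<close> by (simp add: y_def)
    have "[y ^ 2 = y0 ^ 2] (mod int r)" by (intro cong_pow) (simp add: y_def cong_def)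
    hence "[y ^ 2 = - int p] (mod int r)" using y0 cong_trans by blast
    hence "int r dvd y ^ 2 + int p" by (simp add: cong_iff_dvd_diff)
    moreover obtain x where "y = 2 * x + 1" using \<open>odd y\<close> by (elim oddE)
    ultimately have "int r dvd 4 * (x ^ 2 + x + m)"
      by (simp add: p_eq power2_eq_square algebra_simps)
    moreover have "coprime (int r) 4"
    proof -
      have "coprime (int r) (2 ^ 2)" using \<open>odd r\<close> by (subst coprime_power_right_iff) simp
      thus ?thesis by simp
    qed
    ultimately show ?thesis by (blast dest: iffD1[OF coprime_dvd_mult_right_iff])
  qed
qed

end

section \<open>Quadratic residue codes\<close>

locale qr_words = prime_3_mod_4 +
  fixes r t :: nat
  assumes r_pos: "r > 0" and coprime_r_p: "coprime (int r) (int p)"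
begin

definition qmat :: "nat \<Rightarrow> nat \<Rightarrow> int" where
  "qmat i j = res_ind (int i - int j)"

definition qconv :: "(nat \<Rightarrow> nat \<Rightarrow> int) \<Rightarrow> nat \<Rightarrow> nat \<Rightarrow> int" where
  "qconv c a i = (\<Sum>j<p. qmat i j * c a j)"

definition act :: "(nat \<Rightarrow> nat \<Rightarrow> int) \<Rightarrow> (nat \<Rightarrow> nat \<Rightarrow> int) \<Rightarrow> nat \<Rightarrow> nat \<Rightarrow> int" where
  "act M c a i = (\<Sum>b<t. M a b * c b i)"

definition tot :: "(nat \<Rightarrow> nat \<Rightarrow> int) \<Rightarrow> nat \<Rightarrow> int" where
  "tot c a = (\<Sum>i<p. c a i)"

definition wdot :: "(nat \<Rightarrow> nat \<Rightarrow> int) \<Rightarrow> (nat \<Rightarrow> nat \<Rightarrow> int) \<Rightarrow> int" where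
  "wdot b c = (\<Sum>a<t. \<Sum>i<p. b a i * c a i)"

text \<open>The value at position 0 stands for the unknown constant. Allowing a constant instead of
  0 puts all constant words into the code, because Q has equal row sums; they realise every
  total.\<close>

definition code :: "(nat \<Rightarrow> nat \<Rightarrow> int) \<Rightarrow> (nat \<Rightarrow> nat \<Rightarrow> int) \<Rightarrow> bool" where
  "code M c \<longleftrightarrow> (\<forall>a<t. \<forall>i<p. [qconv c a i - act M c a i = qconv c a 0 - act M c a 0] (mod int r))"

definition gauss_root :: "(nat \<Rightarrow> nat \<Rightarrow> int) \<Rightarrow> bool" where
  "gauss_root M \<longleftrightarrow> (\<forall>a<t. \<forall>b<t.
     int r dvd (\<Sum>e<t. M a e * M e b) + M a b + (if a = b then m else 0))"

definition transp :: "(nat \<Rightarrow> nat \<Rightarrow> int) \<Rightarrow> nat \<Rightarrow> nat \<Rightarrow> int" where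
  "transp M a b = M b a"

lemma qmat_transpose:
  assumes "i < p" "j < p"
  shows "qmat i j + qmat j i + (if i = j then 1 else 0) = 1"
proof -
  have "int p dvd int i - int j \<longleftrightarrow> int i mod int p = int j mod int p" by (simp add: mod_eq_dvd_iff)
  also have "\<dots> \<longleftrightarrow> i = j" using assms by simp
  finally show ?thesis
    using res_ind_minus[of "int i - int j"] by (simp add: qmat_def div_ind_def)
qed

lemma qmat_row_sum: "(\<Sum>j<p. qmat i j) = 2 * m - 1"
  using sum_reflect[of res_ind "int i"] by (simp add: qmat_def sum_res_ind)

lemma qmat_col_sum: "(\<Sum>i<p. qmat i j) = 2 * m - 1"
  using sum_shift[of res_ind "- int j"] by (simp add: qmat_def sum_res_ind)

lemma res_ind_diff_mod: "res_ind (k - x mod int p) = res_ind (k - x)"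
  by (metis mod_diff_right_eq res_ind_mod)

lemma qmat_square:
  assumes "i < p" "j < p"
  shows "(\<Sum>l<p. qmat i l * qmat l j) + qmat i j + (if i = j then m else 0) = m"
proof -
  have "(\<Sum>l<p. qmat i l * qmat l j) =
      (\<Sum>l<p. res_ind (int i - int l) * res_ind ((int i - int j) - (int i - int l)))"
    by (simp add: qmat_def)
  also have "\<dots> = (\<Sum>l<p. res_ind (int l) * res_ind ((int i - int j) - int l))"
    by (rule sum_reflect[of "\<lambda>x. res_ind x * res_ind (int i - int j - x)"]) (simp add: res_ind_diff_mod)
  finally have "(\<Sum>l<p. qmat i l * qmat l j) + qmat i j + m * div_ind (int i - int j) = m"
    using res_ind_convolution[of "int i - int j"] by (simp add: qmat_def)
  moreover have "int p dvd int i - int j \<longleftrightarrow> i = j"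
  proof -
    have "int p dvd int i - int j \<longleftrightarrow> int i mod int p = int j mod int p" by (simp add: mod_eq_dvd_iff)
    also have "\<dots> \<longleftrightarrow> i = j" using assms by simp
    finally show ?thesis .
  qed
  ultimately show ?thesis by (cases "i = j") (simp_all add: div_ind_def)
qed

lemma act_add: "act M (\<lambda>a i. x * c a i + y * c' a i) a i = x * act M c a i + y * act M c' a i"
  by (simp add: act_def sum_distrib_left sum.distrib algebra_simps)

lemma qconv_add: "qconv (\<lambda>a i. x * c a i + y * c' a i) a i = x * qconv c a i + y * qconv c' a i"
  by (simp add: qconv_def sum_distrib_left sum.distrib algebra_simps)

lemma qconv_act: "qconv (act M c) a i = act M (qconv c) a i"
proof -
  have "qconv (act M c) a i = (\<Sum>j<p. \<Sum>b<t. qmat i j * (M a b * c b j))"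
    by (simp add: qconv_def act_def sum_distrib_left)
  also have "\<dots> = (\<Sum>b<t. \<Sum>j<p. qmat i j * (M a b * c b j))" by (rule sum.swap)
  also have "\<dots> = act M (qconv c) a i"
    by (simp add: qconv_def act_def sum_distrib_left mult_ac)
  finally show ?thesis .
qed

lemma act_act: "act M (act N c) a i = act (\<lambda>a b. \<Sum>e<t. M a e * N e b) c a i"
proof -
  have "act M (act N c) a i = (\<Sum>e<t. \<Sum>b<t. M a e * (N e b * c b i))"
    by (simp add: act_def sum_distrib_left)
  also have "\<dots> = (\<Sum>b<t. \<Sum>e<t. M a e * (N e b * c b i))" by (rule sum.swap)
  finally show ?thesis by (simp add: act_def sum_distrib_right mult.assoc)
qed

lemma tot_act: "tot (act M c) a = (\<Sum>b<t. M a b * tot c b)"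
proof -
  have "tot (act M c) a = (\<Sum>b<t. \<Sum>i<p. M a b * c b i)"
    unfolding tot_def act_def by (rule sum.swap)
  thus ?thesis by (simp add: tot_def sum_distrib_left)
qed

lemma tot_add: "tot (\<lambda>a i. x * c a i + y * c' a i) a = x * tot c a + y * tot c' a"
  by (simp add: tot_def sum_distrib_left sum.distrib)

lemma tot_qconv: "tot (qconv c) a = (2 * m - 1) * tot c a"
proof -
  have "tot (qconv c) a = (\<Sum>j<p. \<Sum>i<p. qmat i j * c a j)"
    unfolding tot_def qconv_def by (rule sum.swap)
  also have "\<dots> = (\<Sum>j<p. (\<Sum>i<p. qmat i j) * c a j)" by (simp add: sum_distrib_right)
  finally show ?thesis by (simp add: qmat_col_sum tot_def sum_distrib_left)
qed

lemma wdot_add_right: "wdot b (\<lambda>a i. x * c a i + y * c' a i) = x * wdot b c + y * wdot b c'"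
  by (simp add: wdot_def sum_distrib_left sum.distrib algebra_simps)

lemma wdot_const_right: "wdot b (\<lambda>a _. v a) = (\<Sum>a<t. tot b a * v a)"
  by (simp add: wdot_def tot_def sum_distrib_right)

lemma wdot_commute: "wdot b c = wdot c b"
  by (simp add: wdot_def mult.commute)

lemma wdot_act: "wdot b (act M c) = wdot (act (transp M) b) c"
proof -
  have "wdot b (act M c) = (\<Sum>a<t. \<Sum>i<p. \<Sum>e<t. b a i * (M a e * c e i))"
    by (simp add: wdot_def act_def sum_distrib_left)
  also have "\<dots> = (\<Sum>a<t. \<Sum>e<t. \<Sum>i<p. b a i * (M a e * c e i))"
    by (intro sum.cong refl sum.swap)
  also have "\<dots> = (\<Sum>e<t. \<Sum>a<t. \<Sum>i<p. b a i * (M a e * c e i))" by (rule sum.swap)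
  also have "\<dots> = (\<Sum>e<t. \<Sum>i<p. \<Sum>a<t. b a i * (M a e * c e i))"
    by (intro sum.cong refl sum.swap)
  finally show ?thesis by (simp add: wdot_def act_def transp_def sum_distrib_left sum_distrib_right mult_ac)
qed

lemma wdot_qconv: "wdot b (qconv c) + wdot (qconv b) c + wdot b c = (\<Sum>a<t. tot b a * tot c a)"
proof -
  have "(\<Sum>i<p. b a i * qconv c a i) + (\<Sum>i<p. qconv b a i * c a i) + (\<Sum>i<p. b a i * c a i)
      = tot b a * tot c a" for a
  proof -
    have 1: "(\<Sum>i<p. b a i * qconv c a i) = (\<Sum>i<p. \<Sum>j<p. qmat i j * (b a i * c a j))"
      by (simp add: qconv_def sum_distrib_left mult_ac)
    have "(\<Sum>i<p. qconv b a i * c a i) = (\<Sum>j<p. \<Sum>i<p. qmat j i * (b a i * c a j))"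
      by (simp add: qconv_def sum_distrib_left sum_distrib_right mult_ac)
    also have "\<dots> = (\<Sum>i<p. \<Sum>j<p. qmat j i * (b a i * c a j))" by (rule sum.swap)
    finally have 2: "(\<Sum>i<p. qconv b a i * c a i) = (\<Sum>i<p. \<Sum>j<p. qmat j i * (b a i * c a j))" .
    have 3: "(\<Sum>i<p. b a i * c a i) = (\<Sum>i<p. \<Sum>j<p. (if i = j then 1 else 0) * (b a i * c a j))"
      by (intro sum.cong refl) (simp add: if_distrib[of "\<lambda>x. x * _"] cong: if_cong)
    have "(\<Sum>i<p. b a i * qconv c a i) + (\<Sum>i<p. qconv b a i * c a i) + (\<Sum>i<p. b a i * c a i)
       = (\<Sum>i<p. \<Sum>j<p. (qmat i j + qmat j i + (if i = j then 1 else 0)) * (b a i * c a j))"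
      unfolding 1 2 3 by (simp only: sum.distrib distrib_right)
    also have "\<dots> = (\<Sum>i<p. \<Sum>j<p. b a i * c a j)"
      by (intro sum.cong refl) (simp add: qmat_transpose)
    finally show ?thesis by (simp add: tot_def sum_product)
  qed
  thus ?thesis by (simp add: wdot_def flip: sum.distrib)
qed

lemma wdot_cong:
  assumes "\<And>a i. a < t \<Longrightarrow> i < p \<Longrightarrow> [b a i = b' a i] (mod int r)"
    and "\<And>a i. a < t \<Longrightarrow> i < p \<Longrightarrow> [c a i = c' a i] (mod int r)"
  shows "[wdot b c = wdot b' c'] (mod int r)"
  unfolding wdot_def by (intro cong_sum cong_mult assms) auto

lemma tot_mod_cong:
  assumes "\<And>i. i < p \<Longrightarrow> [c a i = c' a i] (mod int r)"
  shows "[tot c a = tot c' a] (mod int r)"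
  unfolding tot_def by (intro cong_sum assms) auto

section \<open>Codewords, their pairing and duality\<close>

lemma codeD:
  assumes "code M c" "a < t" "i < p"
  shows "[qconv c a i = act M c a i + (qconv c a 0 - act M c a 0)] (mod int r)"
proof -
  have "[qconv c a i - act M c a i + act M c a i = qconv c a 0 - act M c a 0 + act M c a i] (mod int r)"
    using assms by (intro cong_add) (auto simp: code_def)
  thus ?thesis by (simp add: add.commute)
qed

lemma code_iff_const:
  "code M c \<longleftrightarrow> (\<exists>w. \<forall>a<t. \<forall>i<p. [qconv c a i - act M c a i = w a] (mod int r))"
proof
  assume "\<exists>w. \<forall>a<t. \<forall>i<p. [qconv c a i - act M c a i = w a] (mod int r)"
  then obtain w where w: "\<And>a i. a < t \<Longrightarrow> i < p \<Longrightarrow> [qconv c a i - act M c a i = w a] (mod int r)"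
    by blast
  have "0 < p" using p_gt_2 by simp
  thus "code M c" unfolding code_def using w cong_sym cong_trans by meson
next
  assume "code M c"
  thus "\<exists>w. \<forall>a<t. \<forall>i<p. [qconv c a i - act M c a i = w a] (mod int r)"
    by (intro exI[of _ "\<lambda>a. qconv c a 0 - act M c a 0"]) (simp add: code_def)
qed

lemma code_add:
  assumes "code M c" "code M c'"
  shows "code M (\<lambda>a i. x * c a i + y * c' a i)"
  unfolding code_iff_const
proof (intro exI allI impI)
  fix a i assume "a < t" "i < p"
  hence "[x * (qconv c a i - act M c a i) + y * (qconv c' a i - act M c' a i) =
     x * (qconv c a 0 - act M c a 0) + y * (qconv c' a 0 - act M c' a 0)] (mod int r)"
    using assms by (intro cong_add cong_mult) (auto simp: code_def)
  thus "[qconv (\<lambda>a i. x * c a i + y * c' a i) a i - act M (\<lambda>a i. x * c a i + y * c' a i) a i =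
     x * (qconv c a 0 - act M c a 0) + y * (qconv c' a 0 - act M c' a 0)] (mod int r)"
    by (simp only: qconv_add act_add right_diff_distrib) (simp add: algebra_simps)
qed

text \<open>B acts on V and Q on positions, so the two commute, and B M = N B replaces M by
  N.\<close>

lemma code_act:
  assumes "code M c" and B: "\<And>a b. a < t \<Longrightarrow> b < t \<Longrightarrow> (\<Sum>e<t. B a e * M e b) = (\<Sum>e<t. N a e * B e b)"
  shows "code N (act B c)"
  unfolding code_iff_const
proof (intro exI allI impI)
  fix a i assume a: "a < t" and i: "i < p"
  have "[act B (\<lambda>b i. qconv c b i - act M c b i) a i
      = act B (\<lambda>b _. qconv c b 0 - act M c b 0) a 0] (mod int r)"
    unfolding act_def[of B] using assms(1) i by (intro cong_sum cong_mult) (auto simp: code_def)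
  moreover have "act B (act M c) a i = act N (act B c) a i"
    unfolding act_act by (simp add: act_def B[OF a])
  moreover have "act B (\<lambda>b i. qconv c b i - act M c b i) a i = act B (qconv c) a i - act B (act M c) a i"
    using act_add[of B 1 "qconv c" "-1" "act M c"] by simp
  ultimately show "[qconv (act B c) a i - act N (act B c) a i = act B (\<lambda>b _. qconv c b 0 - act M c b 0) a 0] (mod int r)"
    by (simp add: qconv_act)
qed

lemma code_cong:
  assumes "\<And>a i. a < t \<Longrightarrow> i < p \<Longrightarrow> [c a i = c' a i] (mod int r)" "code M c"
  shows "code M c'"
  unfolding code_iff_const
proof (intro exI allI impI)
  fix a i assume a: "a < t" and i: "i < p"
  have "[qconv c' a i - act M c' a i = qconv c a i - act M c a i] (mod int r)"
    unfolding qconv_def act_def using a i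
    by (intro cong_diff cong_sum cong_mult cong_refl cong_sym[OF assms(1)]) auto
  also have "[qconv c a i - act M c a i = qconv c a 0 - act M c a 0] (mod int r)"
    using assms(2) a i by (auto simp: code_def)
  finally show "[qconv c' a i - act M c' a i = qconv c a 0 - act M c a 0] (mod int r)" .
qed

text \<open>Adding the defining congruences over all positions expresses p times the constant of a
  codeword through its total.\<close>

lemma code_tot:
  assumes "code M c" "a < t"
  shows "[int p * (qconv c a 0 - act M c a 0) = (2 * m - 1) * tot c a - tot (act M c) a] (mod int r)"
proof -
  have "[(\<Sum>i<p. qconv c a i - act M c a i) = (\<Sum>i<p. qconv c a 0 - act M c a 0)] (mod int r)"
    using assms by (intro cong_sum) (auto simp: code_def)
  thus ?thesis
    by (simp add: sum_subtractf flip: tot_qconv tot_def) (simp add: cong_sym right_diff_distrib)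
qed

text \<open>The relation Q + Q^T + I = J is evaluated between b and c. On c the matrix Q acts as M,
  on b as the transpose of M, up to constants that \<open>code_tot\<close> expresses through totals
  after multiplication by p. This yields the pairing of b with (1 + 2 M) c.\<close>

lemma pairing_aux:
  assumes c: "code M c" and b: "code (transp M) b"
  defines "c' \<equiv> \<lambda>a i. 1 * c a i + 2 * act M c a i"
  shows "[int p * wdot b c' = (\<Sum>a<t. tot b a * tot c' a)] (mod int r)"
proof -
  define w where "w a = qconv c a 0 - act M c a 0" for a
  define v where "v a = qconv b a 0 - act (transp M) b a 0" for a
  define D where "D = wdot b c"
  define E where "E = wdot b (act M c)"
  define BC where "BC = (\<Sum>a<t. tot b a * tot c a)"
  define BMC where "BMC = (\<Sum>a<t. tot b a * tot (act M c) a)"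
  have "[wdot b (qconv c) = wdot b (\<lambda>a i. 1 * act M c a i + 1 * w a)] (mod int r)"
    using codeD[OF c] by (intro wdot_cong) (auto simp: w_def)
  hence 1: "[wdot b (qconv c) = E + (\<Sum>a<t. tot b a * w a)] (mod int r)"
    unfolding wdot_add_right wdot_const_right by (simp add: E_def)
  have "[wdot c (qconv b) = wdot c (\<lambda>a i. 1 * act (transp M) b a i + 1 * v a)] (mod int r)"
    using codeD[OF b] by (intro wdot_cong) (auto simp: v_def)
  hence "[wdot (qconv b) c = wdot (act (transp M) b) c + (\<Sum>a<t. tot c a * v a)] (mod int r)"
    unfolding wdot_add_right wdot_const_right by (simp add: wdot_commute)
  hence 2: "[wdot (qconv b) c = E + (\<Sum>a<t. tot c a * v a)] (mod int r)"
    by (simp add: E_def wdot_act)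
  have "[wdot b (qconv c) + wdot (qconv b) c + D =
     (E + (\<Sum>a<t. tot b a * w a)) + (E + (\<Sum>a<t. tot c a * v a)) + D] (mod int r)"
    by (intro cong_add 1 2 cong_refl)
  hence "[int p * BC = int p * ((E + (\<Sum>a<t. tot b a * w a)) + (E + (\<Sum>a<t. tot c a * v a)) + D)] (mod int r)"
    unfolding D_def wdot_qconv BC_def by (rule cong_scalar_left)
  also have "int p * ((E + (\<Sum>a<t. tot b a * w a)) + (E + (\<Sum>a<t. tot c a * v a)) + D)
    = int p * (D + 2 * E) + ((\<Sum>a<t. tot b a * (int p * w a)) + (\<Sum>a<t. tot c a * (int p * v a)))"
    by (simp add: sum_distrib_left algebra_simps)
  also have "[int p * (D + 2 * E) + ((\<Sum>a<t. tot b a * (int p * w a)) + (\<Sum>a<t. tot c a * (int p * v a)))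
    = int p * (D + 2 * E) + ((\<Sum>a<t. tot b a * ((2 * m - 1) * tot c a - tot (act M c) a))
       + (\<Sum>a<t. tot c a * ((2 * m - 1) * tot b a - tot (act (transp M) b) a)))] (mod int r)"
    using code_tot[OF c] code_tot[OF b]
    by (intro cong_add cong_sum cong_mult cong_refl) (auto simp: w_def v_def)
  also have "(\<Sum>a<t. tot b a * ((2 * m - 1) * tot c a - tot (act M c) a)) = (2 * m - 1) * BC - BMC"
    by (simp add: BC_def BMC_def sum_distrib_left sum_subtractf right_diff_distrib mult.left_commute)
  also have "(\<Sum>a<t. tot c a * ((2 * m - 1) * tot b a - tot (act (transp M) b) a)) = (2 * m - 1) * BC - BMC"
  proof -
    have "BMC = (\<Sum>a<t. \<Sum>e<t. tot b a * (M a e * tot c e))"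
      by (simp add: BMC_def tot_act sum_distrib_left)
    also have "\<dots> = (\<Sum>e<t. \<Sum>a<t. tot b a * (M a e * tot c e))" by (rule sum.swap)
    finally have "BMC = (\<Sum>e<t. tot c e * tot (act (transp M) b) e)"
      by (simp add: tot_act transp_def sum_distrib_left mult_ac)
    thus ?thesis
      by (simp add: BC_def sum_distrib_left sum_subtractf right_diff_distrib mult_ac)
  qed
  finally have "int r dvd int p * BC - (int p * (D + 2 * E) + ((2 * m - 1) * BC - BMC + ((2 * m - 1) * BC - BMC)))"
    by (simp add: cong_iff_dvd_diff)
  \<comment> \<open>The coefficient of BC collapses to p - 2 (2 m - 1) = 1.\<close>
  also have "int p * BC - (int p * (D + 2 * E) + ((2 * m - 1) * BC - BMC + ((2 * m - 1) * BC - BMC)))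
    = (BC + 2 * BMC) - int p * (D + 2 * E)"
    unfolding p_eq by (simp add: algebra_simps)
  also have "D + 2 * E = wdot b c'"
    unfolding c'_def wdot_add_right D_def E_def by simp
  also have "BC + 2 * BMC = (\<Sum>a<t. tot b a * tot c' a)"
    unfolding c'_def tot_add BC_def BMC_def
    by (simp add: sum_distrib_left distrib_left sum.distrib mult.left_commute)
  finally show ?thesis by (simp add: cong_iff_dvd_diff dvd_diff_commute)
qed

text \<open>The matrix \<open>1 + 2 M\<close> is a square root of \<open>- p\<close>, like the Gauss sum; applying
  \<open>pairing_aux\<close> twice therefore gives the pairing of \<open>b\<close> with \<open>- p c\<close>.\<close>

lemma pairing:
  assumes M: "gauss_root M" and c: "code M c" and b: "code (transp M) b"
  shows "[int p * wdot b c = (\<Sum>a<t. tot b a * tot c a)] (mod int r)"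
proof -
  define c1 where "c1 = (\<lambda>a i. 1 * c a i + 2 * act M c a i)"
  define c2 where "c2 = (\<lambda>a i. 1 * c1 a i + 2 * act M c1 a i)"
  have "code M c1" unfolding c1_def by (rule code_add[OF c code_act[OF c refl]])
  hence *: "[int p * wdot b c2 = (\<Sum>a<t. tot b a * tot c2 a)] (mod int r)"
    using pairing_aux[OF _ b] by (simp add: c2_def)
  have c2: "[c2 a i = - int p * c a i] (mod int r)" if a: "a < t" for a i
  proof -
    have "c2 a i - - int p * c a i = 4 * (act M (act M c) a i + act M c a i + m * c a i)"
      unfolding c2_def c1_def act_add p_eq by (simp add: algebra_simps)
    also have "act M (act M c) a i + act M c a i + m * c a i =
       (\<Sum>b<t. ((\<Sum>e<t. M a e * M e b) + M a b + (if a = b then m else 0)) * c b i)"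
    proof -
      have "(\<Sum>b<t. (if a = b then m else 0) * c b i) = m * c a i"
        using a by (simp add: if_distrib[of "\<lambda>x. x * _"] cong: if_cong)
      thus ?thesis by (simp add: act_act distrib_right sum.distrib) (simp add: act_def)
    qed
    also have "int r dvd 4 * \<dots>"
      using M a by (intro dvd_mult dvd_sum dvd_mult2) (auto simp: gauss_root_def)
    finally show ?thesis by (simp add: cong_iff_dvd_diff)
  qed
  have "[int p * wdot b (\<lambda>a i. - int p * c a i + 0 * c a i) = int p * wdot b c2] (mod int r)"
    using c2 by (intro cong_mult wdot_cong) (auto intro: cong_sym)
  also note *
  also have "[(\<Sum>a<t. tot b a * tot c2 a) = (\<Sum>a<t. tot b a * tot (\<lambda>a i. - int p * c a i + 0 * c a i) a)] (mod int r)"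
    using c2 by (intro cong_sum cong_mult tot_mod_cong) auto
  finally have "[(- int p) * (int p * wdot b c) = (- int p) * (\<Sum>a<t. tot b a * tot c a)] (mod int r)"
    unfolding wdot_add_right tot_add by (simp add: sum_distrib_left algebra_simps)
  moreover have "coprime (- int p) (int r)" using coprime_r_p by (simp add: coprime_commute)
  ultimately show ?thesis by (simp only: cong_mult_lcancel)
qed

text \<open>The test words are (Q + 1 + M) z for z a difference of two unit vectors. They belong to
  the code because (Q - M)(Q + 1 + M) = m J - (M^2 + M + m) is congruent to m J, which kills z. As
  Q^T + 1 = J - Q, orthogonality of b to such a word says that Q b - M^T b takes equal values at the
  two positions.\<close>

lemma dual_code:
  assumes M: "gauss_root M"
    and orth: "\<And>c. code M c \<Longrightarrow> (\<And>a. a < t \<Longrightarrow> tot c a = 0) \<Longrightarrow> int r dvd wdot b c"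
  shows "code (transp M) b"
  unfolding code_def
proof (intro allI impI)
  fix a i assume a: "a < t" and i: "i < p"
  have p: "0 < p" using p_gt_2 by simp
  \<comment> \<open>Here z = e_i - e_0 and y = Q z, and c is (Q + 1 + M) applied to z placed in
    component a.\<close>
  define z where "z j = (if j = i then 1 else 0) - (if j = 0 then 1 else (0::int))" for j
  define y where "y j = qmat j i - qmat j 0" for j
  define c where "c a' j = (if a' = a then y j + z j else 0) + M a' a * z j" for a' j
  have sum_z: "(\<Sum>j<p. f j * z j) = f i - f 0" for f :: "nat \<Rightarrow> int"
    using i p by (simp add: z_def right_diff_distrib sum_subtractf if_distrib[of "\<lambda>x. _ * x"] cong: if_cong)
  have sum_y: "(\<Sum>j<p. qmat l j * y j) + y l + m * z l = 0" if "l < p" for l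
  proof -
    have "(\<Sum>j<p. qmat l j * y j) = (\<Sum>j<p. qmat l j * qmat j i) - (\<Sum>j<p. qmat l j * qmat j 0)"
      by (simp add: y_def right_diff_distrib sum_subtractf)
    thus ?thesis using qmat_square[OF that i] qmat_square[OF that p] by (auto simp: y_def z_def)
  qed
  have tot_c: "tot c a' = 0" for a'
  proof -
    have "(\<Sum>j<p. z j) = 0" using sum_z[of "\<lambda>_. 1"] by simp
    moreover have "(\<Sum>j<p. y j) = 0" by (simp add: y_def sum_subtractf qmat_col_sum)
    ultimately show ?thesis
      by (cases "a' = a") (simp_all add: tot_def c_def sum.distrib flip: sum_distrib_left)
  qed
  have "code M c"
    unfolding code_iff_const
  proof (intro exI allI impI)
    fix a' l assume a': "a' < t" and l: "l < p"
    have Qc: "qconv c a' l = (if a' = a then (\<Sum>j<p. qmat l j * y j) + y l else 0) + M a' a * y l"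
    proof -
      have "(\<Sum>j<p. qmat l j * z j) = y l" by (simp add: sum_z y_def)
      moreover have "(\<Sum>j<p. qmat l j * (M a' a * z j)) = M a' a * (\<Sum>j<p. qmat l j * z j)"
        by (simp add: sum_distrib_left mult_ac)
      ultimately show ?thesis
        by (cases "a' = a") (simp_all add: qconv_def c_def distrib_left sum.distrib)
    qed
    have Tc: "act M c a' l = M a' a * (y l + z l) + (\<Sum>e<t. M a' e * M e a) * z l"
    proof -
      have "act M c a' l = (\<Sum>e<t. M a' e * (if e = a then y l + z l else 0)) + (\<Sum>e<t. M a' e * M e a * z l)"
        by (simp add: act_def c_def distrib_left sum.distrib mult.assoc)
      thus ?thesis using a
        by (simp add: sum_distrib_right if_distrib[of "\<lambda>x. _ * x"] cong: if_cong)
    qed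
    have "(qconv c a' l - act M c a' l) - 0 =
      - (((\<Sum>e<t. M a' e * M e a) + M a' a + (if a' = a then m else 0)) * z l)"
      using sum_y[OF l] unfolding Qc Tc by (auto simp: algebra_simps)
    moreover have "int r dvd (\<Sum>e<t. M a' e * M e a) + M a' a + (if a' = a then m else 0)"
      using M a a' by (auto simp: gauss_root_def)
    ultimately show "[qconv c a' l - act M c a' l = (\<lambda>_. 0) a'] (mod int r)"
      by (simp only: cong_iff_dvd_diff dvd_minus_iff dvd_mult2)
  qed
  hence "int r dvd wdot b c" using orth tot_c by blast
  also have "wdot b c = (\<Sum>j<p. b a j * y j) + (b a i - b a 0) + (act (transp M) b a i - act (transp M) b a 0)"
  proof -
    have "wdot b c = (\<Sum>a'<t. (if a' = a then (\<Sum>j<p. b a j * (y j + z j)) else 0)) + (\<Sum>a'<t. M a' a * (\<Sum>j<p. b a' j * z j))"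
      unfolding wdot_def c_def sum.distrib[symmetric]
      by (intro sum.cong refl) (auto simp: distrib_left sum.distrib sum_distrib_left mult_ac)
    also have "\<dots> = (\<Sum>j<p. b a j * (y j + z j)) + (\<Sum>a'<t. M a' a * (\<Sum>j<p. b a' j * z j))"
      using a by simp
    finally show ?thesis
      by (simp add: sum_z distrib_left right_diff_distrib sum.distrib sum_subtractf act_def transp_def)
  qed
  \<comment> \<open>The sum involves the transpose of Q; replacing it by J - I - Q brings in
    \<open>qconv b\<close>, and the totals cancel.\<close>
  also have "(\<Sum>j<p. b a j * y j) = - qconv b a i - b a i + qconv b a 0 + b a 0"
  proof -
    have *: "(\<Sum>j<p. b a j * qmat j l) = tot b a - b a l - qconv b a l" if l: "l < p" for l
    proof -
      have "(\<Sum>j<p. b a j * qmat j l) = (\<Sum>j<p. b a j - (if j = l then b a j else 0) - qmat l j * b a j)"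
      proof (rule sum.cong)
        fix j assume "j \<in> {..<p}"
        hence eq: "qmat j l = 1 - qmat l j - (if j = l then 1 else 0)"
          using qmat_transpose[of j l] l by simp
        show "b a j * qmat j l = b a j - (if j = l then b a j else 0) - qmat l j * b a j"
          unfolding eq by (simp add: algebra_simps)
      qed simp
      thus ?thesis using l by (simp add: sum_subtractf tot_def qconv_def)
    qed
    show ?thesis
      unfolding y_def right_diff_distrib sum_subtractf *[OF i] *[OF p] by simp
  qed
  finally have "int r dvd (qconv b a 0 - act (transp M) b a 0) - (qconv b a i - act (transp M) b a i)"
    by (simp add: algebra_simps)
  thus "[qconv b a i - act (transp M) b a i = qconv b a 0 - act (transp M) b a 0] (mod int r)"
    by (simp add: cong_iff_dvd_diff dvd_diff_commute)
qed

end

section \<open>The square root bound and the quantum code\<close>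

text \<open>The ordered pairs of distinct elements of S have at most |S|^2 - |S| < p - 1 differences
  modulo p, so some nonzero residue is missed.\<close>

lemma missing_difference:
  fixes p :: nat
  assumes "finite S" "(card S)\<^sup>2 - card S + 1 < p"
  shows "\<exists>s\<in>{1..<p}. \<forall>i\<in>S. i < p \<longrightarrow> (i + s) mod p \<notin> S"
proof -
  define P where "P = S \<times> S - (\<lambda>i. (i, i)) ` S"
  define D where "D = (\<lambda>(i, j). nat ((int j - int i) mod int p)) ` P"
  have "card P = card (S \<times> S) - card ((\<lambda>i. (i, i)) ` S)"
    unfolding P_def using assms(1) by (intro card_Diff_subset) auto
  also have "\<dots> = (card S)\<^sup>2 - card S"
    by (simp add: card_cartesian_product card_image inj_on_def power2_eq_square)
  finally have "card P = (card S)\<^sup>2 - card S" .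
  moreover have "finite P" unfolding P_def using assms(1) by simp
  ultimately have "card D < card {1..<p}" "finite D"
    using card_image_le[of P] assms(2) unfolding D_def by (fastforce intro: le_less_trans)+
  hence "\<not> {1..<p} \<subseteq> D" using card_mono not_le by blast
  then obtain s where s: "s \<in> {1..<p}" "s \<notin> D" by blast
  have "(i + s) mod p \<notin> S" if "i \<in> S" "i < p" for i
  proof
    assume j: "(i + s) mod p \<in> S"
    have "(i + s) mod p \<noteq> i"
    proof
      assume "(i + s) mod p = i"
      hence "(i + s) mod p = (i + 0) mod p" using that by simp
      hence "p dvd s" by (metis add_diff_cancel_left' le_add1 mod_eq_dvd_iff_nat add_0_right)
      thus False using s by (auto dest: dvd_imp_le)
    qed
    hence "(i, (i + s) mod p) \<in> P" using that j by (auto simp: P_def)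
    moreover have "(int ((i + s) mod p) - int i) mod int p = int s"
      using s by (simp add: zmod_int mod_simps)
    ultimately have "s \<in> D" unfolding D_def by force
    thus False using s by simp
  qed
  thus ?thesis using s by blast
qed

context qr_words
begin

text \<open>This stands in for nonzero squares of nonzero field elements. The condition on B makes M
  self-adjoint for the form (B v) . w; B may depend on v.\<close>

definition anisotropic :: "(nat \<Rightarrow> nat \<Rightarrow> int) \<Rightarrow> bool" where
  "anisotropic M \<longleftrightarrow> (\<forall>v. (\<exists>a<t. \<not> int r dvd v a) \<longrightarrow>
     (\<exists>B. (\<forall>a<t. \<forall>b<t. (\<Sum>e<t. B a e * M e b) = (\<Sum>e<t. transp M a e * B e b)) \<and>
          \<not> int r dvd (\<Sum>a<t. (\<Sum>b<t. B a b * v b) * v a)))"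

definition shift :: "nat \<Rightarrow> (nat \<Rightarrow> nat \<Rightarrow> int) \<Rightarrow> nat \<Rightarrow> nat \<Rightarrow> int" where
  "shift s c a i = c a ((i + s) mod p)"

lemma sum_shift_nat: "(\<Sum>i<p. f ((i + s) mod p)) = (\<Sum>i<p. f i)"
proof -
  have "(\<Sum>i<p. f (nat ((int i + int s) mod int p))) = (\<Sum>i<p. f (nat (int i mod int p)))"
    by (rule sum_shift) simp
  moreover have "nat ((int i + int s) mod int p) = (i + s) mod p" for i
    by (metis nat_int of_nat_add zmod_int)
  ultimately show ?thesis by simp
qed

text \<open>Q is circulant, and M acts on each position separately.\<close>

lemma code_shift:
  assumes "code M c"
  shows "code M (shift s c)"
  unfolding code_iff_const
proof (intro exI allI impI)
  fix a i assume a: "a < t" and i: "i < p"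
  have "qmat i j = qmat ((i + s) mod p) ((j + s) mod p)" for j
  proof -
    have "(int ((i + s) mod p) - int ((j + s) mod p)) mod int p = (int i - int j) mod int p"
      by (simp add: zmod_int mod_simps)
    thus ?thesis unfolding qmat_def by (metis res_ind_mod)
  qed
  hence "qconv (shift s c) a i = (\<Sum>j<p. qmat ((i + s) mod p) ((j + s) mod p) * c a ((j + s) mod p))"
    by (simp add: qconv_def shift_def)
  also have "\<dots> = qconv c a ((i + s) mod p)"
    unfolding qconv_def by (rule sum_shift_nat[of "\<lambda>j. qmat ((i + s) mod p) j * c a j"])
  finally have "qconv (shift s c) a i - act M (shift s c) a i
     = qconv c a ((i + s) mod p) - act M c a ((i + s) mod p)" by (simp add: act_def shift_def)
  thus "[qconv (shift s c) a i - act M (shift s c) a i = qconv c a 0 - act M c a 0] (mod int r)"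
    using assms a p_gt_2 by (simp add: code_def)
qed

lemma tot_shift: "tot (shift s c) a = tot c a"
  unfolding tot_def shift_def by (rule sum_shift_nat)

text \<open>The square root bound: if some translate of the support of \<open>c\<close> misses the support, then
  \<open>c\<close> pairs to zero with a translate of \<open>B c\<close>, although the pairing only depends on the totals.\<close>

lemma square_root_bound:
  assumes M: "gauss_root M" and an: "anisotropic M" and c: "code M c"
    and a: "a < t" "\<not> int r dvd tot c a"
    and S: "S = {i. i < p \<and> (\<exists>a<t. \<not> int r dvd c a i)}"
  shows "p \<le> (card S)\<^sup>2 - card S + 1"
proof (rule ccontr)
  assume "\<not> ?thesis"
  then obtain s where s: "\<forall>i\<in>S. i < p \<longrightarrow> (i + s) mod p \<notin> S"
    using missing_difference[of S p] S by auto
  have "\<exists>a<t. \<not> int r dvd tot c a" using a by blast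
  then obtain B where
    B: "\<And>a b. a < t \<Longrightarrow> b < t \<Longrightarrow> (\<Sum>e<t. B a e * M e b) = (\<Sum>e<t. transp M a e * B e b)"
    and B': "\<not> int r dvd (\<Sum>a<t. (\<Sum>b<t. B a b * tot c b) * tot c a)"
    using an[unfolded anisotropic_def, rule_format, of "tot c"] by blast
  define b where "b = shift s (act B c)"
  have b: "code (transp M) b" unfolding b_def using code_act[OF c B] by (rule code_shift)
  have "int r dvd b a i * c a i" if "a < t" "i < p" for a i
  proof (cases "i \<in> S")
    case True
    hence "(i + s) mod p \<notin> S" using s that by blast
    hence "int r dvd c e ((i + s) mod p)" if "e < t" for e using that p_gt_2 by (auto simp: S)
    hence "int r dvd b a i" unfolding b_def shift_def act_def by (intro dvd_sum dvd_mult) auto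
    thus ?thesis by simp
  next
    case False
    thus ?thesis using that by (auto simp: S)
  qed
  hence "int r dvd wdot b c" unfolding wdot_def by (intro dvd_sum) auto
  hence "int r dvd int p * wdot b c" by simp
  moreover have "tot b a = (\<Sum>e<t. B a e * tot c e)" for a
    unfolding b_def tot_shift by (rule tot_act)
  ultimately show False
    using cong_dvd_iff[OF pairing[OF M c b]] B' by simp
qed

section \<open>Words over V as strings of t p qudits\<close>

definition word :: "(nat \<Rightarrow> nat) \<Rightarrow> nat \<Rightarrow> nat \<Rightarrow> int" where
  "word x a i = int (x (a * p + i))"

definition reduce :: "(nat \<Rightarrow> nat \<Rightarrow> int) \<Rightarrow> nat \<Rightarrow> nat" where
  "reduce c l = (if l < t * p then nat (c (l div p) (l mod p) mod int r) else 0)"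

text \<open>The total modulo r, which serves as the coset label \<open>S\<close> of the locale
  \<open>css\<close>.\<close>

definition syndrome :: "(nat \<Rightarrow> nat) \<Rightarrow> nat \<Rightarrow> nat" where
  "syndrome x a = (if a < t then nat (tot (word x) a mod int r) else 0)"

lemma index_less: "a < t \<Longrightarrow> i < p \<Longrightarrow> a * p + i < t * p"
  by (metis add.commute less_eq_Suc_le mult_Suc mult_le_mono1 add_less_cancel_left order_less_le_trans)

lemma reduce_in_qbasis: "reduce c \<in> qbasis r (t * p)"
  using r_pos by (auto simp: reduce_def qbasis_def nat_less_iff)

lemma word_reduce:
  assumes "a < t" "i < p"
  shows "[word (reduce c) a i = c a i] (mod int r)"
  using assms r_pos index_less[OF assms] by (simp add: word_def reduce_def cong_def)

lemma word_qsub: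
  assumes "y \<in> qbasis r (t * p)" "a < t" "i < p"
  shows "[word (qsub r (t * p) x y) a i = 1 * word x a i + (- 1) * word y a i] (mod int r)"
  using qsub_cong[OF assms(1) index_less[OF assms(2,3)], of x] by (simp add: word_def)

lemma qdot_word: "qdot (t * p) x y = wdot (word x) (word y)"
proof -
  have "qdot (t * p) x y = (\<Sum>a<t. \<Sum>l = a * p..<a * p + p. int (x l) * int (y l))"
    by (simp add: qdot_def sum.nat_group)
  also have "\<dots> = wdot (word x) (word y)"
    unfolding wdot_def word_def
  proof (rule sum.cong)
    fix a
    show "(\<Sum>l = a * p..<a * p + p. int (x l) * int (y l)) = (\<Sum>i<p. int (x (a * p + i)) * int (y (a * p + i)))"
      by (rule sum.reindex_bij_witness[of _ "\<lambda>i. a * p + i" "\<lambda>l. l - a * p"]) auto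
  qed simp
  finally show ?thesis .
qed

text \<open>A nonzero symbol of V at position i has a nonzero qudit among its coordinates, whose
  index is i modulo p. So a bound on the number of nonzero symbols carries over to qudit
  weight.\<close>

lemma card_support_le_hweight:
  assumes "S = {i. i < p \<and> (\<exists>a<t. \<not> int r dvd word x a i)}"
  shows "card S \<le> hweight (t * p) x"
proof -
  have "S \<subseteq> (\<lambda>l. l mod p) ` {l. l < t * p \<and> x l \<noteq> 0}"
  proof
    fix i assume "i \<in> S"
    then obtain a where a: "i < p" "a < t" "\<not> int r dvd word x a i" using assms by auto
    hence "x (a * p + i) \<noteq> 0" by (auto simp: word_def intro!: Nat.gr0I)
    thus "i \<in> (\<lambda>l. l mod p) ` {l. l < t * p \<and> x l \<noteq> 0}"
      using index_less[OF a(2,1)] a(1) by (intro image_eqI[of _ _ "a * p + i"]) auto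
  qed
  hence "card S \<le> card ((\<lambda>l. l mod p) ` {l. l < t * p \<and> x l \<noteq> 0})" by (intro card_mono) auto
  also have "\<dots> \<le> hweight (t * p) x" unfolding hweight_def by (rule card_image_le) simp
  finally show ?thesis .
qed

lemma syndrome_eq_0_iff: "syndrome x = (\<lambda>_. 0) \<longleftrightarrow> (\<forall>a<t. int r dvd tot (word x) a)"
proof -
  have "nat (k mod int r) = 0 \<longleftrightarrow> int r dvd k" for k
    using r_pos by (metis dvd_eq_mod_eq_0 nat_0_iff of_nat_0_less_iff pos_mod_sign order_antisym_conv)
  thus ?thesis by (auto simp: syndrome_def fun_eq_iff)
qed

lemma syndrome_in_qbasis: "syndrome x \<in> qbasis r t"
  using r_pos by (auto simp: syndrome_def qbasis_def nat_less_iff)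

lemma syndrome_cong: "a < t \<Longrightarrow> [int (syndrome x a) = tot (word x) a] (mod int r)"
  using r_pos by (simp add: syndrome_def cong_def)

lemma light_codeword:
  assumes "gauss_root M" "anisotropic M" "code M (word x)"
    and d: "\<And>k. k < d \<Longrightarrow> k\<^sup>2 - k + 1 < p" and "hweight (t * p) x < d" "a < t"
  shows "int r dvd tot (word x) a"
proof (rule ccontr)
  assume "\<not> ?thesis"
  then have "p \<le> (card {i. i < p \<and> (\<exists>a<t. \<not> int r dvd word x a i)})\<^sup>2
      - card {i. i < p \<and> (\<exists>a<t. \<not> int r dvd word x a i)} + 1"
    using assms by (intro square_root_bound[where a = a and M = M and c = "word x"]) auto
  moreover have "card {i. i < p \<and> (\<exists>a<t. \<not> int r dvd word x a i)} < d"
    using card_support_le_hweight[OF refl, of x] assms(5) by simp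
  ultimately show False using d by fastforce
qed

text \<open>Flips are controlled by the code of M, phases by that of its transpose. A light b
  orthogonal to the subcode lies in the latter by \<open>dual_code\<close>, has total 0 by the
  square root bound, and is then orthogonal to the whole code by \<open>pairing\<close>.\<close>

theorem qr_asym_qcode:
  assumes M: "gauss_root M" and M': "gauss_root (transp M)"
    and an: "anisotropic M" and an': "anisotropic (transp M)"
    and d_pos: "d > 0" and d: "\<And>k. k < d \<Longrightarrow> k\<^sup>2 - k + 1 < p"
  shows "\<exists>Q. is_asym_qcode r (t * p) t d d Q"
proof -
  define C where "C = {x \<in> qbasis r (t * p). code M (word x)}"
  interpret css r "t * p" t d C syndrome
  proof
    show "r > 0" "d > 0" by (fact r_pos d_pos)+
    show "C \<subseteq> qbasis r (t * p)" by (auto simp: C_def)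
    show "qsub r (t * p) x y \<in> C" if "x \<in> C" "y \<in> C" for x y
      using that r_pos
      by (auto simp: C_def intro: code_cong[OF cong_sym[OF word_qsub] code_add])
    show "syndrome (qsub r (t * p) x y) = qsub r t (syndrome x) (syndrome y)"
      if "x \<in> C" "y \<in> C" for x y
    proof (rule qbasis_eqI[of _ r t])
      fix a assume a: "a < t"
      have y: "y \<in> qbasis r (t * p)" using that by (simp add: C_def)
      have "[int (syndrome (qsub r (t * p) x y) a) = tot (word (qsub r (t * p) x y)) a] (mod int r)"
        by (rule syndrome_cong[OF a])
      also have "[tot (word (qsub r (t * p) x y)) a =
          tot (\<lambda>a i. 1 * word x a i + (- 1) * word y a i) a] (mod int r)"
        by (intro tot_mod_cong word_qsub y a)
      also have "tot (\<lambda>a i. 1 * word x a i + (- 1) * word y a i) a = tot (word x) a - tot (word y) a"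
        by (simp only: tot_add)
      also have "[tot (word x) a - tot (word y) a = int (syndrome x a) - int (syndrome y a)] (mod int r)"
        by (intro cong_diff cong_sym[OF syndrome_cong] a)
      also have "[int (syndrome x a) - int (syndrome y a) = int (qsub r t (syndrome x) (syndrome y) a)] (mod int r)"
        by (intro cong_sym[OF qsub_cong] syndrome_in_qbasis a)
      finally show "[int (syndrome (qsub r (t * p) x y) a) =
          int (qsub r t (syndrome x) (syndrome y) a)] (mod int r)" .
    qed (use r_pos syndrome_in_qbasis in auto)
    show "syndrome ` C = qbasis r t"
    proof (intro equalityI subsetI)
      fix v assume v: "v \<in> qbasis r t"
      have "coprime (int p) (int r)" using coprime_r_p by (simp add: coprime_commute)
      then obtain p' where p': "[int p * p' = 1] (mod int r)" using cong_solve_coprime_int by blast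
      \<comment> \<open>The constant word v / p has total v.\<close>
      define c where "c a i = p' * int (v a)" for a and i :: nat
      have "code M c" unfolding code_iff_const
      proof (intro exI allI impI)
        fix a i assume "a < t" "i < p"
        show "[qconv c a i - act M c a i = (2 * m - 1) * (p' * int (v a)) - act M c a 0] (mod int r)"
          by (simp add: qconv_def c_def act_def qmat_row_sum flip: sum_distrib_right)
      qed
      hence "code M (word (reduce c))"
        by (rule code_cong[rotated]) (simp add: cong_sym word_reduce)
      hence "reduce c \<in> C" by (simp add: C_def reduce_in_qbasis)
      moreover have "syndrome (reduce c) = v"
      proof (rule qbasis_eqI[of _ r t])
        fix a assume a: "a < t"
        have "[int (syndrome (reduce c) a) = tot (word (reduce c)) a] (mod int r)"
          by (rule syndrome_cong[OF a])
        also have "[tot (word (reduce c)) a = tot c a] (mod int r)"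
          by (intro tot_mod_cong word_reduce a)
        also have "tot c a = (int p * p') * int (v a)" by (simp add: tot_def c_def)
        also have "[(int p * p') * int (v a) = 1 * int (v a)] (mod int r)"
          by (rule cong_scalar_right[OF p'])
        finally show "[int (syndrome (reduce c) a) = int (v a)] (mod int r)" by simp
      qed (use v syndrome_in_qbasis in auto)
      ultimately show "v \<in> syndrome ` C" by blast
    qed (use syndrome_in_qbasis in auto)
    show "syndrome x = (\<lambda>_. 0)" if "x \<in> C" "hweight (t * p) x < d" for x
      using that light_codeword[OF M an _ d] by (auto simp: syndrome_eq_0_iff C_def)
    show "int r dvd qdot (t * p) b c"
      if b: "hweight (t * p) b < d" and c: "c \<in> C"
        and orth: "\<And>c'. c' \<in> C \<Longrightarrow> syndrome c' = (\<lambda>_. 0) \<Longrightarrow> int r dvd qdot (t * p) b c'" for b c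
    proof -
      have code_b: "code (transp M) (word b)"
      proof (rule dual_code[OF M])
        fix c' assume c': "code M c'" "\<And>a. a < t \<Longrightarrow> tot c' a = 0"
        have "code M (word (reduce c'))"
          using c'(1) by (rule code_cong[rotated]) (simp add: cong_sym word_reduce)
        hence "reduce c' \<in> C" by (simp add: C_def reduce_in_qbasis)
        moreover have "int r dvd tot (word (reduce c')) a" if "a < t" for a
        proof -
          have "[tot (word (reduce c')) a = tot c' a] (mod int r)"
            using that by (intro tot_mod_cong word_reduce)
          thus ?thesis using c'(2)[OF that] by (simp add: cong_0_iff)
        qed
        ultimately have "int r dvd wdot (word b) (word (reduce c'))"
          using orth[of "reduce c'"] by (simp add: syndrome_eq_0_iff qdot_word)
        moreover have "[wdot (word b) (word (reduce c')) = wdot (word b) c'] (mod int r)"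
          by (intro wdot_cong word_reduce) auto
        ultimately show "int r dvd wdot (word b) c'" using cong_dvd_iff by blast
      qed
      have "int r dvd tot (word b) a" if "a < t" for a
        using light_codeword[OF M' an' code_b d b that] .
      hence "int r dvd (\<Sum>a<t. tot (word b) a * tot (word c) a)" by (intro dvd_sum dvd_mult2) auto
      moreover have "[int p * wdot (word b) (word c) = (\<Sum>a<t. tot (word b) a * tot (word c) a)] (mod int r)"
        using c by (intro pairing[OF M _ code_b]) (simp add: C_def)
      ultimately have "int r dvd int p * wdot (word b) (word c)" using cong_dvd_iff by blast
      thus ?thesis using coprime_r_p by (simp add: qdot_word coprime_dvd_mult_right_iff)
    qed
  qed
  show ?thesis by (rule css_asym_qcode)
qed

end

section \<open>Roots of the Gauss polynomial\<close>

text \<open>The set K tells which 2 x 2 blocks are present: all of them for the matrix M, a single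
  one for a form B.\<close>

definition block_diag :: "nat set \<Rightarrow> (nat \<Rightarrow> nat \<Rightarrow> int) \<Rightarrow> nat \<Rightarrow> nat \<Rightarrow> int" where
  "block_diag K N a b = (if a div 2 = b div 2 \<and> a div 2 \<in> K then N (a mod 2) (b mod 2) else 0)"

lemma sum_block_diag:
  assumes "a < 2 * s"
  shows "(\<Sum>e<2*s. block_diag K N a e * f e) = (if a div 2 \<in> K then
    N (a mod 2) 0 * f (2 * (a div 2)) + N (a mod 2) 1 * f (2 * (a div 2) + 1) else 0)"
proof -
  let ?k = "a div 2"
  have "(\<Sum>e<2*s. block_diag K N a e * f e) = (\<Sum>e\<in>{2 * ?k, 2 * ?k + 1}. block_diag K N a e * f e)"
  proof (rule sum.mono_neutral_right)
    have "2 * ?k + 1 < 2 * s" using assms by presburger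
    thus "{2 * ?k, 2 * ?k + 1} \<subseteq> {..<2 * s}" by auto
    have "e = 2 * ?k \<or> e = 2 * ?k + 1" if "a div 2 = e div 2" for e using that by presburger
    thus "\<forall>e\<in>{..<2 * s} - {2 * ?k, 2 * ?k + 1}. block_diag K N a e * f e = 0"
      by (auto simp: block_diag_def)
  qed simp
  thus ?thesis by (simp add: block_diag_def)
qed

lemma block_diag_mult:
  assumes "a < 2 * s"
  shows "(\<Sum>e<2*s. block_diag K N a e * block_diag L N' e b) =
    block_diag (K \<inter> L) (\<lambda>i j. N i 0 * N' 0 j + N i 1 * N' 1 j) a b"
  unfolding sum_block_diag[OF assms] by (auto simp: block_diag_def)

context qr_words
begin

lemma transp_block_diag: "transp (block_diag K N) = block_diag K (\<lambda>i j. N j i)"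
  by (auto simp: transp_def block_diag_def fun_eq_iff)

lemma gauss_root_transp:
  assumes "gauss_root M"
  shows "gauss_root (transp M)"
  unfolding gauss_root_def
proof (intro allI impI)
  fix a b assume "a < t" "b < t"
  hence "int r dvd (\<Sum>e<t. M b e * M e a) + M b a + (if b = a then m else 0)"
    using assms by (auto simp: gauss_root_def)
  thus "int r dvd (\<Sum>e<t. transp M a e * transp M e b) + transp M a b + (if a = b then m else 0)"
    unfolding transp_def by (subst eq_commute[of a b]) (simp add: mult.commute)
qed

definition scalar_mat :: "int \<Rightarrow> nat \<Rightarrow> nat \<Rightarrow> int" where
  "scalar_mat x a b = (if a = b then x else 0)"

lemma gauss_root_scalar:
  assumes "int r dvd x\<^sup>2 + x + m"
  shows "gauss_root (scalar_mat x)"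
  using assms
  by (auto simp: gauss_root_def scalar_mat_def power2_eq_square if_distrib[of "\<lambda>y. y * _"]
      if_distrib[of "\<lambda>y. _ * y"] cong: if_cong)

lemma transp_scalar: "transp (scalar_mat x) = scalar_mat x"
  by (auto simp: transp_def scalar_mat_def fun_eq_iff)

text \<open>Every B commutes with a scalar matrix, so the projection to one nonzero coordinate of v
  will do.\<close>

lemma anisotropic_scalar:
  assumes "prime r"
  shows "anisotropic (scalar_mat x)"
  unfolding anisotropic_def transp_scalar
proof (intro allI impI)
  fix v :: "nat \<Rightarrow> int" assume "\<exists>a<t. \<not> int r dvd v a"
  then obtain a0 where a0: "a0 < t" "\<not> int r dvd v a0" by blast
  define B where "B a b = (if a = a0 \<and> b = a0 then 1 else (0::int))" for a b
  have *: "(\<Sum>b<t. B a b * f b) = (if a = a0 then f a0 else 0)" for a and f :: "nat \<Rightarrow> int"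
    using a0 by (cases "a = a0") (simp_all add: B_def if_distrib[of "\<lambda>y. y * _"] cong: if_cong)
  have "(\<Sum>a<t. (\<Sum>b<t. B a b * v b) * v a) = (\<Sum>a<t. if a = a0 then v a0 * v a0 else 0)"
    by (intro sum.cong) (auto simp: *)
  also have "\<dots> = v a0 * v a0" using a0 by simp
  finally have "(\<Sum>a<t. (\<Sum>b<t. B a b * v b) * v a) = v a0 * v a0" .
  hence "\<not> int r dvd (\<Sum>a<t. (\<Sum>b<t. B a b * v b) * v a)"
    using a0(2) assms by (simp add: prime_dvd_mult_iff)
  moreover have "(\<Sum>e<t. B a e * scalar_mat x e b) = (\<Sum>e<t. scalar_mat x a e * B e b)"
    if "a < t" "b < t" for a b
  proof -
    have "(\<Sum>e<t. B a e * scalar_mat x e b) = (\<Sum>e<t. if e = b then B a b * x else 0)"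
      by (intro sum.cong) (auto simp: scalar_mat_def)
    also have "\<dots> = (\<Sum>e<t. if e = a then x * B a b else 0)" using that by simp
    also have "\<dots> = (\<Sum>e<t. scalar_mat x a e * B e b)"
      by (intro sum.cong) (auto simp: scalar_mat_def)
    finally show ?thesis .
  qed
  ultimately show "\<exists>B. (\<forall>a<t. \<forall>b<t. (\<Sum>e<t. B a e * scalar_mat x e b) = (\<Sum>e<t. scalar_mat x a e * B e b)) \<and>
      \<not> int r dvd (\<Sum>a<t. (\<Sum>b<t. B a b * v b) * v a)"
    by (intro exI[of _ B] conjI allI impI)
qed

section \<open>The 2 x 2 blocks: multiplication by a root theta of X^2 + X + m\<close>

definition mat2 :: "int \<Rightarrow> int \<Rightarrow> int \<Rightarrow> int \<Rightarrow> nat \<Rightarrow> nat \<Rightarrow> int" where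
  "mat2 w x y z i j = (if i = 0 then if j = 0 then w else x else if j = 0 then y else z)"

lemma mat2_transpose: "(\<lambda>i j. mat2 w x y z j i) = mat2 w y x z"
  by (auto simp: mat2_def fun_eq_iff)

lemma mat2_mult: "mat2 w x y z i 0 * mat2 w' x' y' z' 0 j + mat2 w x y z i 1 * mat2 w' x' y' z' 1 j =
    mat2 (w * w' + x * y') (w * x' + x * z') (y * w' + z * y') (y * x' + z * z') i j"
  by (simp add: mat2_def)

text \<open>The block is the companion matrix of X^2 + X + m, that is, multiplication by theta in
  the basis 1, theta.\<close>

lemma gauss_root_block:
  assumes "t = 2 * s"
  shows "gauss_root (block_diag UNIV (mat2 0 (- m) 1 (- 1)))"
  unfolding gauss_root_def
proof (intro allI impI)
  fix a b assume ab: "a < t" "b < t"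
  have "(if a = b then m else 0) = block_diag UNIV (mat2 m 0 0 m) a b"
  proof -
    have "a = b \<longleftrightarrow> a div 2 = b div 2 \<and> a mod 2 = b mod 2"
      by (metis div_mult_mod_eq)
    moreover have "mat2 m 0 0 m (a mod 2) (b mod 2) = (if a mod 2 = b mod 2 then m else 0)"
      by (simp add: mat2_def mod_2_eq_odd)
    ultimately show ?thesis unfolding block_diag_def by (simp only: UNIV_I simp_thms split: if_split) blast
  qed
  moreover have "(\<Sum>e<t. block_diag UNIV (mat2 0 (- m) 1 (- 1)) a e * block_diag UNIV (mat2 0 (- m) 1 (- 1)) e b)
      = block_diag UNIV (mat2 (- m) m (- 1) (1 - m)) a b"
    using ab assms by (simp add: block_diag_mult mat2_mult del: One_nat_def)
  ultimately show "int r dvd (\<Sum>e<t. block_diag UNIV (mat2 0 (- m) 1 (- 1)) a e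
      * block_diag UNIV (mat2 0 (- m) 1 (- 1)) e b)
      + block_diag UNIV (mat2 0 (- m) 1 (- 1)) a b + (if a = b then m else 0)"
    by (simp only:) (simp add: block_diag_def mat2_def)
qed

text \<open>A symmetric block \<open>F\<close> for which \<open>F N\<close> is symmetric is a form balanced with respect to
  \<open>N\<close>; two such forms without common zero suffice.\<close>

lemma anisotropic_block:
  assumes t: "t = 2 * s"
    and forms: "\<And>u v. \<not> int r dvd u \<or> \<not> int r dvd v \<Longrightarrow> \<exists>f g h.
        g * w + h * y = f * x + g * z \<and> \<not> int r dvd f * u * u + 2 * g * u * v + h * v * v"
  shows "anisotropic (block_diag UNIV (mat2 w x y z))"
  unfolding anisotropic_def transp_block_diag mat2_transpose
proof (intro allI impI)
  fix v :: "nat \<Rightarrow> int" assume "\<exists>a<t. \<not> int r dvd v a"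
  then obtain a where a: "a < t" "\<not> int r dvd v a" by blast
  define k where "k = a div 2"
  have "a = 2 * k \<or> a = 2 * k + 1" unfolding k_def by presburger
  hence "\<not> int r dvd v (2 * k) \<or> \<not> int r dvd v (2 * k + 1)" using a(2) by auto
  then obtain f g h where fgh: "g * w + h * y = f * x + g * z"
    "\<not> int r dvd f * v (2 * k) * v (2 * k) + 2 * g * v (2 * k) * v (2 * k + 1) + h * v (2 * k + 1) * v (2 * k + 1)"
    using forms by blast
  \<comment> \<open>The form lives on one block in which v is nonzero. Symmetry of its product with
    the block of M is the single off-diagonal equation in \<open>forms\<close>.\<close>
  define B where "B = block_diag {k} (mat2 f g g h)"
  have "(\<Sum>e<t. B a e * block_diag UNIV (mat2 w x y z) e b)
      = (\<Sum>e<t. block_diag UNIV (mat2 w y x z) a e * B e b)" if "a < t" "b < t" for a b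
  proof -
    have a: "a < 2 * s" using that t by simp
    show ?thesis
      unfolding t B_def block_diag_mult[OF a] mat2_mult using fgh(1) by (simp add: mult.commute)
  qed
  moreover have "(\<Sum>a<t. (\<Sum>b<t. B a b * v b) * v a) = f * v (2 * k) * v (2 * k)
      + 2 * g * v (2 * k) * v (2 * k + 1) + h * v (2 * k + 1) * v (2 * k + 1)"
  proof -
    have "2 * k < t" using a(1) t by (auto simp: k_def)
    let ?g = "\<lambda>b. if b div 2 = k then (mat2 f g g h (b mod 2) 0 * v (2 * k) +
      mat2 f g g h (b mod 2) 1 * v (2 * k + 1)) * v b else 0"
    have "(\<Sum>a<t. (\<Sum>b<t. B a b * v b) * v a) = (\<Sum>b<2*s. ?g b)"
      unfolding t by (intro sum.cong refl) (simp add: B_def sum_block_diag)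
    also have "\<dots> = (\<Sum>b\<in>{2 * k, 2 * k + 1}. ?g b)"
    proof (rule sum.mono_neutral_right)
      show "{2 * k, 2 * k + 1} \<subseteq> {..<2 * s}" using \<open>2 * k < t\<close> t by auto
      have "b = 2 * k \<or> b = 2 * k + 1" if "b div 2 = k" for b using that by presburger
      thus "\<forall>b\<in>{..<2 * s} - {2 * k, 2 * k + 1}. ?g b = 0" by auto
    qed simp
    finally show ?thesis by (simp add: mat2_def) (simp add: algebra_simps)
  qed
  ultimately show "\<exists>B. (\<forall>a<t. \<forall>b<t. (\<Sum>e<t. B a e * block_diag UNIV (mat2 w x y z) e b)
      = (\<Sum>e<t. block_diag UNIV (mat2 w y x z) a e * B e b)) \<and>
      \<not> int r dvd (\<Sum>a<t. (\<Sum>b<t. B a b * v b) * v a)"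
    using fgh(2) by (intro exI[of _ B]) simp
qed

text \<open>The form is the norm of u + v theta. If v were invertible modulo r, then - u / v would
  be a root of X^2 + X + m.\<close>

lemma norm_form_anisotropic:
  assumes "prime r" and noroot: "\<And>x. \<not> int r dvd x\<^sup>2 + x + m"
    and dvd: "int r dvd u * u - u * v + m * v * v"
  shows "int r dvd u \<and> int r dvd v"
proof -
  have prime: "prime (int r)" using assms(1) by simp
  have v: "int r dvd v"
  proof (rule ccontr)
    assume "\<not> int r dvd v"
    hence "coprime (int r) v" using prime by (simp add: prime_imp_coprime)
    hence "coprime v (int r)" by (simp add: coprime_commute)
    then obtain w where "[v * w = 1] (mod int r)" using cong_solve_coprime_int by blast
    hence w: "int r dvd v * w - 1" by (simp add: cong_iff_dvd_diff)
    have "(- u * w)\<^sup>2 + (- u * w) + m = w\<^sup>2 * (u * u - u * v + m * v * v)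
       + (v * w - 1) * (u * w - m * (v * w + 1))"
      by (simp add: power2_eq_square algebra_simps)
    hence "int r dvd (- u * w)\<^sup>2 + (- u * w) + m" using dvd w by simp
    thus False using noroot by blast
  qed
  moreover have "int r dvd u"
  proof -
    have "int r dvd v * (m * v - u)" using v by simp
    hence "int r dvd (u * u - u * v + m * v * v) - v * (m * v - u)" using dvd dvd_diff by blast
    hence "int r dvd u * u" by (simp add: algebra_simps)
    thus ?thesis using prime by (simp add: prime_dvd_mult_iff)
  qed
  ultimately show ?thesis by blast
qed

text \<open>The two forms are the coordinates of (u + v theta)^2 in the basis 1, theta. The norm of
  this square is the square of the norm, so a common zero is a zero of the norm form.\<close>

lemma square_forms_anisotropic:
  assumes "prime r" "\<And>x. \<not> int r dvd x\<^sup>2 + x + m"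
    and A: "int r dvd u * u - m * v * v" and B: "int r dvd 2 * u * v - v * v"
  shows "int r dvd u \<and> int r dvd v"
proof -
  let ?N = "u * u - u * v + m * v * v" and ?A = "u * u - m * v * v" and ?B = "2 * u * v - v * v"
  have "?N * ?N = ?A * (?A - ?B) + ?B * (m * ?B)" by (simp add: algebra_simps)
  also have "int r dvd \<dots>" by (intro dvd_add dvd_mult2 A B)
  finally have "int r dvd ?N" using assms(1) by (simp add: prime_dvd_mult_iff)
  thus ?thesis using norm_form_anisotropic assms(1,2) by blast
qed

end

theorem theorem15:
  fixes p ps t :: nat
  assumes "prime p" and "[p = 3] (mod 4)"
    and "prime ps" and "t \<ge> 1" and "\<not> p dvd ps"
    and "QuadRes (int p) (int (ps ^ t))"
  shows "\<exists>Q dz dx d :: nat. is_asym_qcode ps (t * p) t dz dx Q \<and>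
           d > 0 \<and> d^2 - d + 1 \<ge> p \<and> dz \<ge> d \<and> dx \<ge> d"
proof -
  interpret prime_3_mod_4 p using assms by unfold_locales
  have "ps \<noteq> p" using assms(5) by auto
  hence "coprime (int ps) (int p)" using assms(1,3) by (simp add: primes_coprime)
  then interpret qr_words p ps t
    using assms(3) by unfold_locales (auto simp: prime_gt_0_nat)
  \<comment> \<open>With the least such d, every k < d violates the square root bound. The
    subtraction on naturals is harmless, as d is at most its square.\<close>
  define d where "d = (LEAST d. p \<le> d\<^sup>2 - d + 1)"
  have "p \<le> p\<^sup>2 - p + 1"
  proof -
    have "2 * p \<le> p\<^sup>2" using p_gt_2 by (simp add: power2_eq_square)
    thus ?thesis by linarith
  qed
  hence d: "p \<le> d\<^sup>2 - d + 1" unfolding d_def by (rule LeastI)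
  hence d_pos: "d > 0" using p_gt_2 by (intro gr0I) simp
  have d_least: "k\<^sup>2 - k + 1 < p" if "k < d" for k
    using not_less_Least that unfolding d_def by fastforce
  have "\<exists>Q. is_asym_qcode ps (t * p) t d d Q"
  proof (cases "\<exists>x. int ps dvd x\<^sup>2 + x + m")
    case True
    then obtain x where "int ps dvd x\<^sup>2 + x + m" by blast
    thus ?thesis using qr_asym_qcode[of "scalar_mat x" d] gauss_root_scalar anisotropic_scalar
        transp_scalar assms(3) d_pos d_least by metis
  next
    case False
    have "even t"
    proof (rule ccontr)
      assume "odd t"
      then obtain k where k: "t = 2 * k + 1" by (elim oddE)
      have "chi (int (ps ^ t)) = 1"
      proof -
        have "\<not> p dvd ps ^ t" using assms(1,5) prime_dvd_power by blast
        hence "\<not> int p dvd int (ps ^ t)" by (simp only: int_dvd_int_iff) simp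
        thus ?thesis using assms(6) by (simp add: chi_def Legendre_def cong_0_iff)
      qed
      moreover have "int (ps ^ t) = int (ps ^ k) * int (ps ^ k) * int ps"
        unfolding k mult_2 power_add by simp
      hence "chi (int (ps ^ t)) = chi (int (ps ^ k)) * chi (int (ps ^ k)) * chi (int ps)"
        by (simp only: chi_mult)
      ultimately have "chi (int ps) = 1"
        using chi_square[of "int (ps ^ k)"] by (auto simp: div_ind_def split: if_splits)
      hence "QuadRes (int p) (int ps)" by (auto simp: chi_def Legendre_def split: if_splits)
      thus False using root_exists assms(3) \<open>ps \<noteq> p\<close> False by blast
    qed
    then obtain s where s: "t = 2 * s" by (elim evenE)
    define M where "M = block_diag UNIV (mat2 0 (- m) 1 (- 1))"
    note forms = square_forms_anisotropic[OF assms(3)]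
    have "anisotropic M" unfolding M_def
    proof (rule anisotropic_block[OF s])
      fix u v assume "\<not> int ps dvd u \<or> \<not> int ps dvd v"
      then consider "\<not> int ps dvd u * u - m * v * v" | "\<not> int ps dvd 2 * u * v - v * v"
        using forms False by blast
      thus "\<exists>f g h. g * 0 + h * 1 = f * - m + g * - 1 \<and>
          \<not> int ps dvd f * u * u + 2 * g * u * v + h * v * v"
      proof cases
        \<comment> \<open>The witnesses are the coefficients of the two coordinates of (u + v
          theta)^2.\<close>
        case 1 thus ?thesis by (intro exI[of _ 1] exI[of _ 0] exI[of _ "- m"]) simp
      next
        case 2 thus ?thesis by (intro exI[of _ 0] exI[of _ 1] exI[of _ "- 1"]) simp
      qed
    qed
    moreover have "anisotropic (transp M)" unfolding M_def transp_block_diag mat2_transpose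
    proof (rule anisotropic_block[OF s])
      fix u v assume uv: "\<not> int ps dvd u \<or> \<not> int ps dvd v"
      \<comment> \<open>The transposed block is multiplication by theta in the basis 1 + theta, 1,
        so the pair (u, v) now stands for (u + v) + u theta.\<close>
      hence "\<not> int ps dvd u + v \<or> \<not> int ps dvd u" by (auto simp: dvd_add_right_iff)
      hence "\<not> int ps dvd (u + v) * (u + v) - m * u * u \<or> \<not> int ps dvd 2 * (u + v) * u - u * u"
        using forms False by blast
      moreover have "(u + v) * (u + v) - m * u * u = (u * u + 2 * u * v) + (v * v - m * u * u)"
        "2 * (u + v) * u - u * u = u * u + 2 * u * v"
        by (simp_all add: algebra_simps)
      ultimately consider "\<not> int ps dvd u * u + 2 * u * v" | "\<not> int ps dvd v * v - m * u * u"
        by (metis dvd_add)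
      thus "\<exists>f g h. g * 0 + h * - m = f * 1 + g * - 1 \<and>
          \<not> int ps dvd f * u * u + 2 * g * u * v + h * v * v"
      proof cases
        case 1 thus ?thesis by (intro exI[of _ 1] exI[of _ 1] exI[of _ 0]) simp
      next
        case 2 thus ?thesis by (intro exI[of _ "- m"] exI[of _ 0] exI[of _ 1]) (simp add: algebra_simps)
      qed
    qed
    moreover have "gauss_root M" unfolding M_def by (rule gauss_root_block[OF s])
    ultimately show ?thesis
      using qr_asym_qcode[of M d] gauss_root_transp d_pos d_least by blast
  qed
  thus ?thesis using d d_pos by blast
qed

end
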